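(* Let $H$ be a separable complex Hilbert space, $A$ a strictly positive selfadjoint operator on $H$, and $f:\sigma(A)\to[0,\infty)$ a continuous function. Let $\mathbb{A}:\mathrm{dom}(\mathbb{A})\subset\mathcal{H}\to\mathcal{H}$ be the operator $\mathbb{A}(u,v)=(v,-Au-f(A)v)$ on $\mathcal{H}=H^1\times H$ defined in the context. Then $\mathbb{A}:\mathrm{dom}(\mathbb{A})\to\mathcal{H}$ is bijective, i.e. $0\notin\sigma(\mathbb{A})$, if and only if $$\sup_{s\in\sigma(A)}\frac{f(s)}{s}<\infty .$$
   Context: $(H,\langle\cdot,\cdot\rangle,\|\cdot\|)$ is a separable complex Hilbert space and $A:\mathrm{dom}(A)\subset H\to H$ is a strictly positive selfadjoint linear operator (so $\sigma(A)$ is a nonempty closed subset of $(0,\infty)$; $A$ may be bounded or unbounded and $A^{-1}$ is not necessarily compact). $f:\sigma(A)\to[0,\infty)$ is continuous, and $f(A)=\int_{\sigma(A)}f(s)\,dE_A(s)$ is the selfadjoint operator given by the functional calculus, $E_A$ being the spectral measure of $A$. For $r>0$, $H^r=\mathrm{dom}(A^{r/2})$ with norm $\|u\|_r=\|A^{r/2}u\|$. The phase space is $\mathcal{H}=H^1\times H$ with norm $\|(u,v)\|_{\mathcal{H}}^2=\|u\|_1^2+\|v\|^2$. The operator $\mathbb{A}$ is $\mathbb{A}(u,v)=(v,\,-(Au+f(A)v))$ with domain $\mathrm{dom}(\mathbb{A})=\{(u,v)\in\mathcal{H}: v\in H^1,\ Au+f(A)v\in H\}$. Here, when $u\notin\mathrm{dom}(A)$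 or $v\notin\mathrm{dom}(f(A))$, $Au$ and $f(A)v$ are understood by duality, as the functionals $w\mapsto\langle Aw,u\rangle$ on $\mathrm{dom}(A)$ and $w\mapsto\langle f(A)w,v\rangle$ on $\mathrm{dom}(f(A))$; thus $Au+f(A)v\in H$ means that there is $h\in H$ (then denoted $Au+f(A)v$) with $\langle Aw,u\rangle+\langle f(A)w,v\rangle=\langle w,h\rangle$ for all $w\in\mathrm{dom}(A)\cap\mathrm{dom}(f(A))$. The operator $\mathbb{A}$ is closed and densely defined. *)

theory Defs
  imports "HOL-Analysis.Analysis"
begin

section \<open>Complex Hilbert spaces\<close>

class complex_vector = real_vector +
  fixes scaleC :: "complex \<Rightarrow> 'a \<Rightarrow> 'a" (infixr "*\<^sub>C" 75)
  assumes scaleC_add_right: "a *\<^sub>C (x + y) = a *\<^sub>C x + a *\<^sub>C y"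
    and scaleC_add_left: "(a + b) *\<^sub>C x = a *\<^sub>C x + b *\<^sub>C x"
    and scaleC_scaleC: "a *\<^sub>C b *\<^sub>C x = (a * b) *\<^sub>C x"
    and scaleC_one: "1 *\<^sub>C x = x"
    and scaleR_scaleC: "r *\<^sub>R x = complex_of_real r *\<^sub>C x"

text \<open>The inner product is linear in the first and conjugate linear in the second argument.
  Positive definiteness is contained in the last axiom.\<close>

class complex_hilbert = complex_vector + banach +
  fixes cinner :: "'a \<Rightarrow> 'a \<Rightarrow> complex"
  assumes cinner_commute: "cinner x y = cnj (cinner y x)"
    and cinner_add_left: "cinner (x + y) z = cinner x z + cinner y z"
    and cinner_scaleC_left: "cinner (a *\<^sub>C x) y = a * cinner x y"
    and cinner_norm: "cinner x x = complex_of_real ((norm x)\<^sup>2)"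

instantiation prod :: (complex_vector, complex_vector) complex_vector
begin

definition scaleC_prod :: "complex \<Rightarrow> 'a \<times> 'b \<Rightarrow> 'a \<times> 'b"
  where "scaleC_prod a p = (a *\<^sub>C fst p, a *\<^sub>C snd p)"

instance
  by standard
    (auto simp: scaleC_prod_def scaleC_add_right scaleC_add_left scaleC_scaleC scaleC_one
      scaleR_prod_def scaleR_scaleC)

end

section \<open>Unbounded operators\<close>

text \<open>An operator is given by its domain \<open>D\<close> and a function \<open>T\<close>; the values of \<open>T\<close>
  outside \<open>D\<close> are irrelevant.\<close>

definition clinear_operator ::
  "'a::complex_vector set \<Rightarrow> ('a \<Rightarrow> 'b::complex_vector) \<Rightarrow> bool"
  where "clinear_operator D T \<longleftrightarrow>
    0 \<in> D \<and>
    (\<forall>x\<in>D. \<forall>y\<in>D. x + y \<in> D \<and> T (x + y) = T x + T y) \<and>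
    (\<forall>a. \<forall>x\<in>D. a *\<^sub>C x \<in> D \<and> T (a *\<^sub>C x) = a *\<^sub>C T x)"

definition operator_graph :: "'a set \<Rightarrow> ('a \<Rightarrow> 'b) \<Rightarrow> ('a \<times> 'b) set"
  where "operator_graph D T = {(x, T x) | x. x \<in> D}"

definition adjoint_graph ::
  "'h::complex_hilbert set \<Rightarrow> ('h \<Rightarrow> 'h) \<Rightarrow> ('h \<times> 'h) set"
  where "adjoint_graph D T = {(y, z). \<forall>x\<in>D. cinner (T x) y = cinner x z}"

definition selfadjoint :: "'h::complex_hilbert set \<Rightarrow> ('h \<Rightarrow> 'h) \<Rightarrow> bool"
  where "selfadjoint D T \<longleftrightarrow>
    clinear_operator D T \<and> closure D = UNIV \<and> adjoint_graph D T = operator_graph D T"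

text \<open>Strict positivity is meant in the sense that the spectrum of \<open>T\<close> stays away from \<open>0\<close>,
  not just that \<open>cinner (T x) x > 0\<close> for \<open>x \<noteq> 0\<close>.\<close>

definition strictly_positive :: "'h::complex_hilbert set \<Rightarrow> ('h \<Rightarrow> 'h) \<Rightarrow> bool"
  where "strictly_positive D T \<longleftrightarrow>
    (\<exists>c>0. \<forall>x\<in>D. c * (norm x)\<^sup>2 \<le> Re (cinner (T x) x))"

text \<open>Resolvent set and spectrum of an operator with domain \<open>D\<close> acting in the space with
  underlying set \<open>X\<close> and norm \<open>N\<close>.\<close>

definition resolvent_set ::
  "'a::complex_vector set \<Rightarrow> ('a \<Rightarrow> real) \<Rightarrow> 'a set \<Rightarrow> ('a \<Rightarrow> 'a) \<Rightarrow> complex set"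
  where "resolvent_set X N D T =
    {z. bij_betw (\<lambda>x. T x - z *\<^sub>C x) D X \<and>
        (\<exists>C. \<forall>x\<in>D. N x \<le> C * N (T x - z *\<^sub>C x))}"

definition spectrum ::
  "'a::complex_vector set \<Rightarrow> ('a \<Rightarrow> real) \<Rightarrow> 'a set \<Rightarrow> ('a \<Rightarrow> 'a) \<Rightarrow> complex set"
  where "spectrum X N D T = - resolvent_set X N D T"

text \<open>The spectrum of a selfadjoint operator is real, so it is recorded as a set of reals.\<close>

definition real_spectrum :: "'h::complex_hilbert set \<Rightarrow> ('h \<Rightarrow> 'h) \<Rightarrow> real set"
  where "real_spectrum D T = {s. complex_of_real s \<in> spectrum UNIV norm D T}"

section \<open>Spectral measures and functional calculus\<close>

text \<open>Boundedness of \<open>E B\<close> follows from idempotence and symmetry.\<close>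

definition projection_valued_measure ::
  "(real set \<Rightarrow> 'h \<Rightarrow> 'h::complex_hilbert) \<Rightarrow> bool"
  where "projection_valued_measure E \<longleftrightarrow>
    (\<forall>B\<in>sets borel.
       clinear_operator UNIV (E B) \<and> E B \<circ> E B = E B \<and>
       (\<forall>x y. cinner (E B x) y = cinner x (E B y))) \<and>
    E {} = (\<lambda>x. 0) \<and> E UNIV = id \<and>
    (\<forall>B\<in>sets borel. \<forall>C\<in>sets borel. E (B \<inter> C) = E B \<circ> E C) \<and>
    (\<forall>B::nat \<Rightarrow> real set. range B \<subseteq> sets borel \<longrightarrow> disjoint_family B \<longrightarrow>
       (\<forall>x. (\<lambda>n. E (B n) x) sums E (\<Union>n. B n) x))"

text \<open>The scalar measure \<open>B \<mapsto> cinner (E B x) x\<close>.\<close>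

definition scalar_measure ::
  "(real set \<Rightarrow> 'h \<Rightarrow> 'h) \<Rightarrow> 'h::complex_hilbert \<Rightarrow> real measure"
  where "scalar_measure E x =
    measure_of UNIV (sets borel) (\<lambda>B. ennreal (Re (cinner (E B x) x)))"

text \<open>The domain and the values of the integral of \<open>g\<close> over \<open>S\<close> with respect to \<open>E\<close>.  The
  integral of \<open>g\<close> against the complex measure \<open>B \<mapsto> cinner (E B x) y\<close> is written out by
  polarization.  The domain is dense, hence the values are determined by testing against it.\<close>

definition spectral_integral_dom ::
  "(real set \<Rightarrow> 'h \<Rightarrow> 'h) \<Rightarrow> real set \<Rightarrow> (real \<Rightarrow> real) \<Rightarrow> 'h::complex_hilbert set"
  where "spectral_integral_dom E S g =
    {x. (\<integral>\<^sup>+s\<in>S. ennreal ((g s)\<^sup>2) \<partial>scalar_measure E x) < \<infinity>}"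

definition spectral_form ::
  "(real set \<Rightarrow> 'h \<Rightarrow> 'h) \<Rightarrow> real set \<Rightarrow> (real \<Rightarrow> real) \<Rightarrow> 'h::complex_hilbert \<Rightarrow> 'h \<Rightarrow> complex"
  where "spectral_form E S g x y =
    (let Q = (\<lambda>z. complex_of_real (LINT s:S|scalar_measure E z. g s))
     in (Q (x + y) - Q (x - y) + \<i> * Q (x + \<i> *\<^sub>C y) - \<i> * Q (x - \<i> *\<^sub>C y)) / 4)"

definition spectral_integral ::
  "(real set \<Rightarrow> 'h \<Rightarrow> 'h) \<Rightarrow> real set \<Rightarrow> (real \<Rightarrow> real) \<Rightarrow> 'h \<Rightarrow> 'h::complex_hilbert"
  where "spectral_integral E S g x =
    (THE h. \<forall>y\<in>spectral_integral_dom E S g. cinner h y = spectral_form E S g x y)"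

text \<open>\<open>E\<close> is the spectral measure of the operator: the operator, including its domain, is the
  integral of the identity function with respect to \<open>E\<close>.\<close>

definition is_spectral_measure ::
  "(real set \<Rightarrow> 'h \<Rightarrow> 'h) \<Rightarrow> 'h::complex_hilbert set \<Rightarrow> ('h \<Rightarrow> 'h) \<Rightarrow> bool"
  where "is_spectral_measure E D T \<longleftrightarrow>
    projection_valued_measure E \<and>
    D = spectral_integral_dom E UNIV (\<lambda>s. s) \<and>
    (\<forall>x\<in>D. T x = spectral_integral E UNIV (\<lambda>s. s) x)"

definition fcalc_dom ::
  "(real set \<Rightarrow> 'h \<Rightarrow> 'h) \<Rightarrow> 'h::complex_hilbert set \<Rightarrow> ('h \<Rightarrow> 'h) \<Rightarrow> (real \<Rightarrow> real) \<Rightarrow> 'h set"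
  where "fcalc_dom E D T g = spectral_integral_dom E (real_spectrum D T) g"

definition fcalc ::
  "(real set \<Rightarrow> 'h \<Rightarrow> 'h) \<Rightarrow> 'h::complex_hilbert set \<Rightarrow> ('h \<Rightarrow> 'h) \<Rightarrow> (real \<Rightarrow> real) \<Rightarrow> 'h \<Rightarrow> 'h"
  where "fcalc E D T g = spectral_integral E (real_spectrum D T) g"

section \<open>The damped wave operator\<close>

text \<open>In this section \<open>E\<close> is the spectral measure of the operator \<open>A\<close> with domain \<open>D\<close>.\<close>

definition Hr :: "(real set \<Rightarrow> 'h \<Rightarrow> 'h) \<Rightarrow> 'h::complex_hilbert set \<Rightarrow> ('h \<Rightarrow> 'h) \<Rightarrow> real \<Rightarrow> 'h set"
  where "Hr E D A r = fcalc_dom E D A (\<lambda>s. s powr (r / 2))"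

definition Hr_norm ::
  "(real set \<Rightarrow> 'h \<Rightarrow> 'h) \<Rightarrow> 'h::complex_hilbert set \<Rightarrow> ('h \<Rightarrow> 'h) \<Rightarrow> real \<Rightarrow> 'h \<Rightarrow> real"
  where "Hr_norm E D A r u = norm (fcalc E D A (\<lambda>s. s powr (r / 2)) u)"

definition phase_space ::
  "(real set \<Rightarrow> 'h \<Rightarrow> 'h) \<Rightarrow> 'h::complex_hilbert set \<Rightarrow> ('h \<Rightarrow> 'h) \<Rightarrow> ('h \<times> 'h) set"
  where "phase_space E D A = Hr E D A 1 \<times> UNIV"

definition phase_norm ::
  "(real set \<Rightarrow> 'h \<Rightarrow> 'h) \<Rightarrow> 'h::complex_hilbert set \<Rightarrow> ('h \<Rightarrow> 'h) \<Rightarrow> 'h \<times> 'h \<Rightarrow> real"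
  where "phase_norm E D A = (\<lambda>(u, v). sqrt ((Hr_norm E D A 1 u)\<^sup>2 + (norm v)\<^sup>2))"

text \<open>\<open>represents E D A f u v h\<close> says that \<open>h\<close> is \<open>A u + f(A) v\<close>, understood by duality.\<close>

definition represents ::
  "(real set \<Rightarrow> 'h \<Rightarrow> 'h) \<Rightarrow> 'h::complex_hilbert set \<Rightarrow> ('h \<Rightarrow> 'h) \<Rightarrow> (real \<Rightarrow> real) \<Rightarrow>
    'h \<Rightarrow> 'h \<Rightarrow> 'h \<Rightarrow> bool"
  where "represents E D A f u v h \<longleftrightarrow>
    (\<forall>w\<in>D \<inter> fcalc_dom E D A f.
       cinner (A w) u + cinner (fcalc E D A f w) v = cinner w h)"

definition damped_dom ::
  "(real set \<Rightarrow> 'h \<Rightarrow> 'h) \<Rightarrow> 'h::complex_hilbert set \<Rightarrow> ('h \<Rightarrow> 'h) \<Rightarrow> (real \<Rightarrow> real) \<Rightarrow> ('h \<times> 'h) set"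
  where "damped_dom E D A f =
    {(u, v). (u, v) \<in> phase_space E D A \<and> v \<in> Hr E D A 1 \<and> (\<exists>h. represents E D A f u v h)}"

definition damped_op ::
  "(real set \<Rightarrow> 'h \<Rightarrow> 'h) \<Rightarrow> 'h::complex_hilbert set \<Rightarrow> ('h \<Rightarrow> 'h) \<Rightarrow> (real \<Rightarrow> real) \<Rightarrow>
    'h \<times> 'h \<Rightarrow> 'h \<times> 'h"
  where "damped_op E D A f = (\<lambda>(u, v). (v, - (THE h. represents E D A f u v h)))"

end

theory Submission
  imports Defs
begin

text \<open>For a Borel function \<open>\<phi>\<close>, the vector \<open>\<phi>(A) x\<close> is obtained as a limit along simple functions, so
  that \<open>norm (\<phi>(A) x)\<close> is the norm of \<open>\<phi>\<close> in \<open>L\<^sup>2\<close> of the scalar measure of \<open>x\<close>.  The equation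
  \<open>(v, - (A u + f(A) v)) = (g, h)\<close> can only be solved by \<open>v = g\<close> and \<open>u = - (A\<^sup>-\<^sup>1 h + (f/s)(A) g)\<close>.  This
  \<open>u\<close> lies in \<open>H\<^sup>1\<close>, and depends continuously on \<open>(g, h)\<close>, if \<open>f/s\<close> is bounded on the spectrum.
  Conversely, taking \<open>h = 0\<close> and \<open>g = A\<^sup>-\<^sup>1\<^sup>/\<^sup>2 y\<close> shows that \<open>f/s\<close> is square integrable with respect to
  the scalar measure of every \<open>y\<close>.  This forces \<open>f/s\<close> to be essentially bounded, hence bounded
  on the spectrum by continuity, because the spectrum is the support of the spectral measure.\<close>

section \<open>Complex inner products\<close>

text \<open>\<open>spectral_integral\<close> is a definite description over a polarized quadratic
  form, which is awkward to compute with. \<open>calc\<close> replaces it by an explicit limit for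
  functions on the whole line, and membership in a domain becomes \<open>sq_integrable\<close>. The
  other obstacle is duality: \<open>u\<close> and \<open>v\<close> are seen only through test
  vectors lying in \<open>D\<close> and in the domain of \<open>f(A)\<close> at once, and
  \<open>u\<close> need not lie in \<open>D\<close>. In the uniqueness and necessity arguments the
  test vectors are therefore cut off to sets \<open>core n\<close> on which \<open>s\<close> and
  \<open>f s\<close> are both bounded; for necessity, Fatou's lemma removes the cut-off at the end.
  The choice of \<open>g\<close> as A^(-1/2) y comes from dividing A u = - f(A) g by A^(1/2): the
  result is A^(1/2) u = - (f/s)(A) y, and the left side is a vector of H because \<open>u\<close>
  lies in \<open>H^1\<close>. Bijectivity is purely algebraic, whereas \<open>resolvent_set\<close>
  also demands a bounded inverse; the explicit formula for \<open>u\<close> supplies that bound in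
  the phase norm.\<close>

lemma cinner_add_right: "cinner x (y + z) = cinner x y + cinner x (z::'h::complex_hilbert)"
  by (metis cinner_add_left cinner_commute complex_cnj_add)

lemma cinner_scaleC_right: "cinner x (a *\<^sub>C y) = cnj a * cinner x (y::'h::complex_hilbert)"
  by (metis cinner_scaleC_left cinner_commute complex_cnj_mult)

lemma cinner_scaleR_left: "cinner (r *\<^sub>R x) (y::'h::complex_hilbert) = r *\<^sub>R cinner x y"
  by (simp add: scaleR_scaleC cinner_scaleC_left scaleR_conv_of_real)

lemma cinner_scaleR_right: "cinner x (r *\<^sub>R (y::'h::complex_hilbert)) = r *\<^sub>R cinner x y"
  by (simp add: scaleR_scaleC cinner_scaleC_right scaleR_conv_of_real)

lemma norm_add_cinner:
  "(norm (x + (y::'h::complex_hilbert)))\<^sup>2 = (norm x)\<^sup>2 + (norm y)\<^sup>2 + 2 * Re (cinner x y)"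
proof -
  have "complex_of_real ((norm (x + y))\<^sup>2) = cinner (x + y) (x + y)"
    by (simp only: cinner_norm)
  also have "\<dots> = cinner x x + cinner y y + (cinner x y + cnj (cinner x y))"
    by (simp add: cinner_add_left cinner_add_right cinner_commute[of y x])
  also have "\<dots> = complex_of_real ((norm x)\<^sup>2 + (norm y)\<^sup>2 + 2 * Re (cinner x y))"
    by (simp add: cinner_norm complex_add_cnj)
  finally show ?thesis
    by (simp only: of_real_eq_iff)
qed

text \<open>The usual order is reversed: the norm and its triangle inequality come with the class,
  and expanding the square of \<open>norm (x + y)\<close> leaves Cauchy-Schwarz for the real
  part.\<close>

lemma Re_cinner_le: "Re (cinner x (y::'h::complex_hilbert)) \<le> norm x * norm y"
proof -
  have "(norm (x + y))\<^sup>2 \<le> (norm x + norm y)\<^sup>2"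
    by (intro power_mono norm_triangle_ineq) auto
  then show ?thesis
    unfolding norm_add_cinner by (simp add: power2_sum)
qed

lemma norm_scaleC: "norm (a *\<^sub>C (x::'h::complex_hilbert)) = cmod a * norm x"
proof -
  have "complex_of_real ((norm (a *\<^sub>C x))\<^sup>2) = a * cnj a * cinner x x"
    by (simp only: cinner_norm[symmetric] cinner_scaleC_left cinner_scaleC_right mult_ac)
  also have "\<dots> = complex_of_real ((cmod a * norm x)\<^sup>2)"
    unfolding complex_norm_square[symmetric] by (simp add: cinner_norm power_mult_distrib)
  finally have "(norm (a *\<^sub>C x))\<^sup>2 = (cmod a * norm x)\<^sup>2"
    by (simp only: of_real_eq_iff)
  then show ?thesis
    by (rule power2_eq_imp_eq) auto
qed

lemma norm_cinner_le: "norm (cinner x (y::'h::complex_hilbert)) \<le> norm x * norm y"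
proof (cases "cinner x y = 0")
  case False
  \<comment> \<open>A phase that rotates \<open>cinner x y\<close> onto the positive half-line, so
    that passing to the real part loses nothing.\<close>
  define a where "a = cnj (cinner x y) / norm (cinner x y)"
  have "cmod a = 1"
    using False by (simp add: a_def norm_divide)
  have "a * cinner x y = norm (cinner x y)"
    using False by (simp add: a_def complex_norm_square[symmetric] power2_eq_square mult.commute)
  then have "norm (cinner x y) = Re (cinner (a *\<^sub>C x) y)"
    by (simp add: cinner_scaleC_left)
  also have "\<dots> \<le> norm x * norm y"
    using Re_cinner_le[of "a *\<^sub>C x" y] \<open>cmod a = 1\<close> by (simp add: norm_scaleC)
  finally show ?thesis .
qed simp

interpretation cinner: bounded_bilinear cinner
proof
  show "\<exists>K. \<forall>a b. norm (cinner a b) \<le> norm a * norm b * K"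
    using norm_cinner_le by (metis mult.right_neutral)
qed (simp_all add: cinner_add_left cinner_add_right cinner_scaleR_left cinner_scaleR_right)

lemma cinner_eq_imp_eq:
  assumes "\<And>y. cinner h y = cinner h' (y::'h::complex_hilbert)"
  shows "h = h'"
proof -
  have "cinner (h - h') (h - h') = 0"
    using assms by (simp add: cinner.diff_left)
  then show ?thesis
    by (simp add: cinner_norm)
qed

lemma dense_cinner_eq_imp_eq:
  fixes h h' :: "'h::complex_hilbert"
  assumes dense: "closure S = UNIV" and eq: "\<And>y. y \<in> S \<Longrightarrow> cinner h y = cinner h' y"
  shows "h = h'"
proof (rule cinner_eq_imp_eq)
  fix y
  obtain z where z: "\<And>n. z n \<in> S" "z \<longlonglongrightarrow> y"
    using dense closure_sequential[of y S] by auto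
  have "(\<lambda>n. cinner h (z n)) \<longlonglongrightarrow> cinner h y" "(\<lambda>n. cinner h' (z n)) \<longlonglongrightarrow> cinner h' y"
    using z(2) by (auto intro: cinner.tendsto)
  then show "cinner h y = cinner h' y"
    using eq[OF z(1)] LIMSEQ_unique by simp
qed

lemma bounded_linear_scaleC: "bounded_linear (\<lambda>x::'h::complex_hilbert. a *\<^sub>C x)"
  by (rule bounded_linear_intro[where K = "cmod a"])
    (simp_all add: scaleC_add_right scaleR_scaleC scaleC_scaleC norm_scaleC mult.commute)

lemmas tendsto_scaleC = bounded_linear.tendsto[OF bounded_linear_scaleC]

lemma scaleC_zero_left: "0 *\<^sub>C (x::'a::complex_vector) = 0"
  using scaleR_scaleC[of 0 x] by simp

lemma tendsto_norm_square_zero_cancel: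
  fixes f :: "'a \<Rightarrow> 'b::real_normed_vector"
  assumes "((\<lambda>n. (norm (f n))\<^sup>2) \<longlongrightarrow> 0) F"
  shows "(f \<longlongrightarrow> 0) F"
  using tendsto_real_sqrt[OF assms] by (simp add: tendsto_norm_zero_iff)

section \<open>Integration with respect to a projection valued measure\<close>

locale pvm =
  fixes E :: "real set \<Rightarrow> 'h \<Rightarrow> 'h::complex_hilbert"
  assumes pvm: "projection_valued_measure E"
begin

abbreviation \<mu> :: "'h \<Rightarrow> real measure"
  where "\<mu> \<equiv> scalar_measure E"

lemma E_add: "B \<in> sets borel \<Longrightarrow> E B (x + y) = E B x + E B y"
  and E_scaleC: "B \<in> sets borel \<Longrightarrow> E B (a *\<^sub>C x) = a *\<^sub>C E B x"
  using pvm by (auto simp: projection_valued_measure_def clinear_operator_def)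

lemma E_scaleR: "B \<in> sets borel \<Longrightarrow> E B (r *\<^sub>R x) = r *\<^sub>R E B x"
  by (simp add: scaleR_scaleC E_scaleC)

lemma E_commute: "B \<in> sets borel \<Longrightarrow> cinner (E B x) y = cinner x (E B y)"
  using pvm by (auto simp: projection_valued_measure_def)

lemma E_E: "B \<in> sets borel \<Longrightarrow> C \<in> sets borel \<Longrightarrow> E B (E C x) = E (B \<inter> C) x"
  using pvm by (auto simp: projection_valued_measure_def)

lemma E_empty: "E {} x = 0" and E_UNIV: "E UNIV x = x"
  using pvm by (auto simp: projection_valued_measure_def)

lemma E_sums:
  assumes "range B \<subseteq> sets borel" "disjoint_family B"
  shows "(\<lambda>n::nat. E (B n) x) sums E (\<Union>n. B n) x"
  using pvm assms by (auto simp: projection_valued_measure_def)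

lemma cinner_E_self:
  assumes "B \<in> sets borel"
  shows "cinner (E B x) x = complex_of_real ((norm (E B x))\<^sup>2)"
proof -
  have "cinner (E B x) x = cinner (E B (E B x)) x"
    using assms by (simp add: E_E)
  also have "\<dots> = cinner (E B x) (E B x)"
    using assms by (rule E_commute)
  finally show ?thesis
    by (simp only: cinner_norm)
qed

lemma norm_E_le:
  assumes "B \<in> sets borel"
  shows "norm (E B x) \<le> norm x"
proof -
  have "(norm (E B x))\<^sup>2 \<le> norm (E B x) * norm x"
    using Re_cinner_le[of "E B x" x] by (simp add: cinner_E_self[OF assms])
  then have "norm (E B x) * norm (E B x) \<le> norm (E B x) * norm x"
    by (simp add: power2_eq_square)
  then show ?thesis
    by (cases "E B x = 0") auto
qed

lemma bounded_linear_E: "B \<in> sets borel \<Longrightarrow> bounded_linear (E B)"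
  by (rule bounded_linear_intro[where K = 1]) (simp_all add: E_add E_scaleR norm_E_le)

lemma E_sum: "B \<in> sets borel \<Longrightarrow> E B (\<Sum>i\<in>I. x i) = (\<Sum>i\<in>I. E B (x i))"
  by (rule linear_sum[OF bounded_linear.linear[OF bounded_linear_E]])

lemma E_Un:
  assumes "B \<in> sets borel" "C \<in> sets borel" "B \<inter> C = {}"
  shows "E (B \<union> C) x = E B x + E C x"
proof -
  have "disjoint_family (binaryset B C)"
    using assms(3) by (auto simp: disjoint_family_on_def binaryset_def)
  then have "(\<lambda>n. E (binaryset B C n) x) sums E (B \<union> C) x"
    using E_sums[of "binaryset B C" x] assms
    by (simp add: UN_binaryset_eq range_binaryset_eq)
  moreover have "(\<lambda>n. E (binaryset B C n) x) sums (\<Sum>n\<in>{0, 1}. E (binaryset B C n) x)"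
    by (rule sums_finite) (auto simp: binaryset_def E_empty)
  ultimately have "E (B \<union> C) x = (\<Sum>n\<in>{0, 1}. E (binaryset B C n) x)"
    by (rule sums_unique2)
  then show ?thesis
    by (simp add: binaryset_def)
qed

lemma E_finite_Union:
  assumes "finite I" "\<And>i. i \<in> I \<Longrightarrow> B i \<in> sets borel" "disjoint_family_on B I"
  shows "E (\<Union>i\<in>I. B i) x = (\<Sum>i\<in>I. E (B i) x)"
  using assms
proof (induction I rule: finite_induct)
  case (insert i I)
  have "B i \<inter> (\<Union>i\<in>I. B i) = {}"
    using insert.prems(2) insert.hyps by (fastforce simp: disjoint_family_on_def)
  moreover have "disjoint_family_on B I"
    using insert.prems(2) by (auto simp: disjoint_family_on_def)
  ultimately show ?case
    using insert by (simp add: E_Un sets.finite_UN)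
qed (simp add: E_empty)

lemma sets_scalar_measure [simp, measurable_cong]: "sets (\<mu> x) = sets borel"
  and space_scalar_measure [simp]: "space (\<mu> x) = UNIV"
  by (simp_all add: scalar_measure_def sets.sigma_sets_eq[of "borel :: real measure", simplified])

text \<open>\<open>measure_of\<close> falls back to the zero measure unless the given set function
  is a measure, so the values are known only after this check. Countable additivity is that of
  \<open>E\<close>, carried through the continuous functional \<open>cinner _ x\<close>.\<close>

lemma emeasure_scalar_measure:
  assumes "B \<in> sets borel"
  shows "emeasure (\<mu> x) B = ennreal ((norm (E B x))\<^sup>2)"
proof -
  let ?m = "\<lambda>B. ennreal (Re (cinner (E B x) x))"
  have "countably_additive (sets borel) ?m"
  proof (rule countably_additiveI)
    fix B :: "nat \<Rightarrow> real set"
    assume B: "range B \<subseteq> sets borel" "disjoint_family B"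
    have nn: "0 \<le> Re (cinner (E (B n) x) x)" for n
      using B(1) by (simp add: cinner_E_self range_subsetD)
    have "(\<lambda>n. cinner (E (B n) x) x) sums cinner (E (\<Union>n. B n) x) x"
      by (rule bounded_linear.sums[OF cinner.bounded_linear_left E_sums[OF B]])
    then have "(\<lambda>n. Re (cinner (E (B n) x) x)) sums Re (cinner (E (\<Union>n. B n) x) x)"
      by (simp add: sums_complex_iff)
    then show "(\<Sum>n. ?m (B n)) = ?m (\<Union> (range B))"
      using suminf_ennreal2[OF nn] by (simp add: sums_iff)
  qed
  moreover have "positive (sets borel) ?m"
    by (simp add: positive_def E_empty cinner.zero_left)
  ultimately have "emeasure (\<mu> x) B = ?m B"
    unfolding scalar_measure_def
    using assms sets.sigma_algebra_axioms[of "borel::real measure"]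
    by (intro emeasure_measure_of_sigma) simp_all
  then show ?thesis
    by (simp add: cinner_E_self[OF assms])
qed

lemma finite_scalar_measure [simp]: "finite_measure (\<mu> x)"
  by (rule finite_measureI) (simp add: emeasure_scalar_measure)

lemma measure_scalar_measure:
  "B \<in> sets borel \<Longrightarrow> measure (\<mu> x) B = (norm (E B x))\<^sup>2"
  by (simp add: measure_def emeasure_scalar_measure)

section \<open>Functional calculus for simple functions\<close>

definition simple_calc :: "(real \<Rightarrow> real) \<Rightarrow> 'h \<Rightarrow> 'h"
  where "simple_calc \<phi> x = (\<Sum>r\<in>range \<phi>. r *\<^sub>R E (\<phi> -` {r}) x)"

lemma simple_function_vimage:
  "simple_function borel \<theta> \<Longrightarrow> (\<theta> :: real \<Rightarrow> 't) -` {t} \<in> sets borel"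
  "simple_function borel \<theta> \<Longrightarrow> finite (range \<theta>)"
  using simple_functionD[of "borel :: real measure" \<theta>] by (auto simp: space_borel)

text \<open>The sum may be taken over the level sets of any finer simple map. With pairs as values
  of \<open>\<theta>\<close> this is a common refinement of two simple functions, on which sums and
  products are computed termwise.\<close>

lemma simple_calc_comp:
  assumes \<theta>: "simple_function borel (\<theta> :: real \<Rightarrow> 't)"
  shows "simple_calc (\<lambda>s. h (\<theta> s)) x = (\<Sum>t\<in>range \<theta>. h t *\<^sub>R E (\<theta> -` {t}) x)"
proof -
  note [simp] = simple_function_vimage[OF \<theta>]
  have "(\<Sum>t\<in>range \<theta>. h t *\<^sub>R E (\<theta> -` {t}) x) =
      (\<Sum>r\<in>h ` range \<theta>. \<Sum>t | t \<in> range \<theta> \<and> h t = r. h t *\<^sub>R E (\<theta> -` {t}) x)"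
    by (rule sum.image_gen) simp
  also have "\<dots> = (\<Sum>r\<in>h ` range \<theta>. r *\<^sub>R E ((\<lambda>s. h (\<theta> s)) -` {r}) x)"
  proof (rule sum.cong)
    fix r
    have "(\<Sum>t | t \<in> range \<theta> \<and> h t = r. h t *\<^sub>R E (\<theta> -` {t}) x) =
        r *\<^sub>R (\<Sum>t | t \<in> range \<theta> \<and> h t = r. E (\<theta> -` {t}) x)"
      by (simp add: scaleR_sum_right)
    also have "(\<Sum>t | t \<in> range \<theta> \<and> h t = r. E (\<theta> -` {t}) x) =
        E (\<Union>t\<in>{t \<in> range \<theta>. h t = r}. \<theta> -` {t}) x"
      by (rule E_finite_Union[symmetric]) (auto simp: disjoint_family_on_def)
    also have "(\<Union>t\<in>{t \<in> range \<theta>. h t = r}. \<theta> -` {t}) = (\<lambda>s. h (\<theta> s)) -` {r}"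
      by auto
    finally show "(\<Sum>t | t \<in> range \<theta> \<and> h t = r. h t *\<^sub>R E (\<theta> -` {t}) x) =
        r *\<^sub>R E ((\<lambda>s. h (\<theta> s)) -` {r}) x" .
  qed simp
  finally show ?thesis
    by (simp add: simple_calc_def image_image)
qed

lemma simple_calc_add:
  assumes "simple_function borel \<phi>" "simple_function borel \<psi>"
  shows "simple_calc (\<lambda>s. \<phi> s + \<psi> s) x = simple_calc \<phi> x + simple_calc \<psi> x"
proof -
  note comp = simple_calc_comp[OF simple_function_Pair[OF assms], where x = x]
  show ?thesis
    using comp[of "\<lambda>p. fst p + snd p"] comp[of fst] comp[of snd]
    by (simp add: scaleR_add_left sum.distrib)
qed

lemma simple_calc_scaleR:
  assumes "simple_function borel \<phi>"
  shows "simple_calc (\<lambda>s. c * \<phi> s) x = c *\<^sub>R simple_calc \<phi> x"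
  using simple_calc_comp[OF assms, of "\<lambda>r. c * r" x]
  by (simp add: simple_calc_def scaleR_sum_right)

lemma simple_calc_diff:
  assumes "simple_function borel \<phi>" "simple_function borel \<psi>"
  shows "simple_calc (\<lambda>s. \<phi> s - \<psi> s) x = simple_calc \<phi> x - simple_calc \<psi> x"
  using simple_calc_add[OF assms(1) simple_function_mult[OF simple_function_const assms(2)], of "-1" x]
    simple_calc_scaleR[OF assms(2), of "-1"]
  by simp

lemma simple_calc_mult:
  assumes "simple_function borel \<phi>" "simple_function borel \<psi>"
  shows "simple_calc \<phi> (simple_calc \<psi> x) = simple_calc (\<lambda>s. \<phi> s * \<psi> s) x"
proof -
  let ?\<theta> = "\<lambda>s. (\<phi> s, \<psi> s)"
  note \<theta> = simple_function_Pair[OF assms]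
  note comp = simple_calc_comp[OF \<theta>]
  note [simp] = simple_function_vimage[OF \<theta>]
  have "simple_calc (\<lambda>s. fst (?\<theta> s)) (simple_calc (\<lambda>s. snd (?\<theta> s)) x) =
      (\<Sum>p\<in>range ?\<theta>. \<Sum>q\<in>range ?\<theta>. (fst p * snd q) *\<^sub>R E (?\<theta> -` {p} \<inter> ?\<theta> -` {q}) x)"
    unfolding comp[of fst] comp[of snd]
    by (simp only: E_sum E_scaleR E_E scaleR_sum_right scaleR_scaleR simple_function_vimage[OF \<theta>])
  \<comment> \<open>Distinct level sets are disjoint, so composing their projections gives
    \<open>E {}\<close>, which is \<open>0\<close>; only the diagonal of the double sum
    survives.\<close>
  also have "\<dots> = (\<Sum>p\<in>range ?\<theta>. \<Sum>q\<in>range ?\<theta>.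
      if p = q then (fst p * snd p) *\<^sub>R E (?\<theta> -` {p}) x else 0)"
  proof (intro sum.cong refl)
    fix p q
    show "(fst p * snd q) *\<^sub>R E (?\<theta> -` {p} \<inter> ?\<theta> -` {q}) x =
        (if p = q then (fst p * snd p) *\<^sub>R E (?\<theta> -` {p}) x else 0)"
    proof (cases "p = q")
      case False
      then have "?\<theta> -` {p} \<inter> ?\<theta> -` {q} = {}"
        by auto
      then show ?thesis
        using False by (simp only: E_empty scaleR_zero_right if_False)
    qed simp
  qed
  also have "\<dots> = (\<Sum>p\<in>range ?\<theta>. (fst p * snd p) *\<^sub>R E (?\<theta> -` {p}) x)"
    by (simp add: sum.delta')
  also have "\<dots> = simple_calc (\<lambda>s. (\<lambda>p. fst p * snd p) (?\<theta> s)) x"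
    by (rule comp[symmetric])
  finally show ?thesis
    by simp
qed

lemma simple_calc_add_right:
  assumes "simple_function borel \<phi>"
  shows "simple_calc \<phi> (x + y) = simple_calc \<phi> x + simple_calc \<phi> y"
  using simple_function_vimage[OF assms]
  by (simp add: simple_calc_def E_add scaleR_add_right sum.distrib)

lemma simple_calc_scaleC_right:
  assumes "simple_function borel \<phi>"
  shows "simple_calc \<phi> (a *\<^sub>C x) = a *\<^sub>C simple_calc \<phi> x"
proof -
  interpret bounded_linear "\<lambda>x::'h. a *\<^sub>C x"
    by (rule bounded_linear_scaleC)
  show ?thesis
    using simple_function_vimage[OF assms] by (simp add: simple_calc_def E_scaleC sum scaleR)
qed

lemma simple_calc_commute:
  assumes "simple_function borel \<phi>"
  shows "cinner (simple_calc \<phi> x) y = cinner x (simple_calc \<phi> y)"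
  using simple_function_vimage[OF assms]
  by (simp add: simple_calc_def cinner.sum_left cinner.sum_right
      cinner_scaleR_left cinner_scaleR_right E_commute)

lemma simple_calc_indicator:
  assumes "B \<in> sets borel"
  shows "simple_calc (indicator B) x = E B x"
proof -
  \<comment> \<open>The indicator misses a value when \<open>B\<close> is empty or everything; the
    absent level set is empty and adds nothing.\<close>
  have "(\<Sum>r\<in>range (indicator B). r *\<^sub>R E (indicator B -` {r}) x) =
      (\<Sum>r\<in>{0, 1}. r *\<^sub>R E (indicator B -` {r :: real}) x)"
  proof (rule sum.mono_neutral_left)
    show "\<forall>r\<in>{0, 1} - range (indicator B). r *\<^sub>R E (indicator B -` {r :: real}) x = 0"
    proof
      fix r :: real
      assume "r \<in> {0, 1} - range (indicator B)"
      then have "indicator B -` {r} = {}"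
        by auto
      then show "r *\<^sub>R E (indicator B -` {r}) x = 0"
        by (simp only: E_empty scaleR_zero_right)
    qed
  qed (auto simp: indicator_def)
  moreover have "indicator B -` {1 :: real} = B"
    by (auto simp: indicator_def)
  ultimately show ?thesis
    by (simp add: simple_calc_def)
qed

lemma measurable_scalar_measure [simp]: "borel_measurable (\<mu> x) = borel_measurable borel"
  by (rule measurable_cong_sets) simp_all

lemma cinner_simple_calc_self:
  assumes "simple_function borel \<phi>"
  shows "cinner (simple_calc \<phi> x) x = complex_of_real (\<integral>s. \<phi> s \<partial>\<mu> x)"
proof -
  interpret finite_measure "\<mu> x" by simp
  note [simp] = simple_function_vimage[OF assms]
  have "\<phi> s = (\<Sum>r\<in>range \<phi>. r * indicator (\<phi> -` {r}) s)" for s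
  proof -
    have "(\<Sum>r\<in>range \<phi>. r * indicator (\<phi> -` {r}) s) = (\<Sum>r\<in>range \<phi>. if r = \<phi> s then r else 0)"
      by (intro sum.cong) (auto simp: indicator_def)
    then show ?thesis
      by simp
  qed
  then have "(\<integral>s. \<phi> s \<partial>\<mu> x) = (\<integral>s. (\<Sum>r\<in>range \<phi>. r * indicator (\<phi> -` {r}) s) \<partial>\<mu> x)"
    by (intro Bochner_Integration.integral_cong refl)
  also have "\<dots> = (\<Sum>r\<in>range \<phi>. r * (norm (E (\<phi> -` {r}) x))\<^sup>2)"
    by (subst Bochner_Integration.integral_sum) 
      (simp_all add: measure_scalar_measure less_top[symmetric])
  finally show ?thesis
    by (simp add: simple_calc_def cinner.sum_left cinner_scaleR_left cinner_E_self scaleR_conv_of_real)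
qed

text \<open>By symmetry the squared norm is the quadratic form of the twofold application, and
  applying a simple function twice squares it. This isometry into L^2 of the scalar measure drives
  the later limit arguments.\<close>

lemma norm_simple_calc:
  assumes "simple_function borel \<phi>"
  shows "(norm (simple_calc \<phi> x))\<^sup>2 = (\<integral>s. (\<phi> s)\<^sup>2 \<partial>\<mu> x)"
proof -
  have "complex_of_real ((norm (simple_calc \<phi> x))\<^sup>2) =
      cinner (simple_calc \<phi> (simple_calc \<phi> x)) x"
    by (simp only: simple_calc_commute[OF assms, of _ x] cinner_norm)
  also have "\<dots> = complex_of_real (\<integral>s. (\<phi> s)\<^sup>2 \<partial>\<mu> x)"
    using cinner_simple_calc_self[of "\<lambda>s. \<phi> s * \<phi> s" x] assms
    by (simp add: simple_calc_mult power2_eq_square)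
  finally show ?thesis
    by (simp only: of_real_eq_iff)
qed

section \<open>Extension to Borel functions\<close>

definition sq_integrable :: "(real \<Rightarrow> real) \<Rightarrow> 'h \<Rightarrow> bool"
  where "sq_integrable \<phi> x \<longleftrightarrow> \<phi> \<in> borel_measurable borel \<and> integrable (\<mu> x) (\<lambda>s. (\<phi> s)\<^sup>2)"

text \<open>Measurability is a separate conjunct of \<open>sq_integrable\<close>: integrability of
  the square makes only the square of \<open>\<phi>\<close> measurable.\<close>

lemma sq_integrable_measurable: "sq_integrable \<phi> x \<Longrightarrow> \<phi> \<in> borel_measurable borel"
  by (simp add: sq_integrable_def)

lemma sq_integrable_mono:
  assumes w: "sq_integrable w x" and [measurable]: "\<phi> \<in> borel_measurable borel"
    and le: "\<And>s. \<bar>\<phi> s\<bar> \<le> \<bar>w s\<bar>"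
  shows "sq_integrable \<phi> x"
proof -
  have "integrable (\<mu> x) (\<lambda>s. (\<phi> s)\<^sup>2)"
  proof (rule Bochner_Integration.integrable_bound)
    show "integrable (\<mu> x) (\<lambda>s. (w s)\<^sup>2)"
      using w by (simp add: sq_integrable_def)
    have "(\<phi> s)\<^sup>2 \<le> (w s)\<^sup>2" for s
      using le by (simp only: abs_le_square_iff)
    then show "AE s in \<mu> x. norm ((\<phi> s)\<^sup>2) \<le> norm ((w s)\<^sup>2)"
      by simp
  qed simp
  then show ?thesis
    by (simp add: sq_integrable_def)
qed

lemma sq_integrable_const: "sq_integrable (\<lambda>s. c) x"
  using finite_measure.integrable_const[OF finite_scalar_measure] by (simp add: sq_integrable_def)

lemma sq_integrable_bounded:
  assumes "\<phi> \<in> borel_measurable borel" "\<And>s. \<bar>\<phi> s\<bar> \<le> C"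
  shows "sq_integrable \<phi> x"
  using assms by (intro sq_integrable_mono[OF sq_integrable_const[of C]]) (auto intro: order_trans[OF _ abs_ge_self])

lemma sq_integrable_simple: "simple_function borel \<phi> \<Longrightarrow> sq_integrable \<phi> x"
proof -
  assume \<phi>: "simple_function borel \<phi>"
  then have "\<bar>\<phi> s\<bar> \<le> Max (abs ` range \<phi>)" for s
    using simple_function_vimage(2) by (intro Max_ge) auto
  then show ?thesis
    using \<phi> by (intro sq_integrable_bounded) (auto simp: borel_measurable_simple_function)
qed

lemma sq_integrable_scale: "sq_integrable \<phi> x \<Longrightarrow> sq_integrable (\<lambda>s. c * \<phi> s) x"
  by (auto simp: sq_integrable_def power_mult_distrib)

lemma sq_integrable_abs: "sq_integrable \<phi> x \<Longrightarrow> sq_integrable (\<lambda>s. \<bar>\<phi> s\<bar>) x"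
  by (auto simp: sq_integrable_def)

lemma sq_integrable_mult:
  assumes "sq_integrable \<phi> x" "sq_integrable \<psi> x"
  shows "integrable (\<mu> x) (\<lambda>s. \<phi> s * \<psi> s)"
proof (rule Bochner_Integration.integrable_bound[of "\<mu> x" "\<lambda>s. (\<phi> s)\<^sup>2 + (\<psi> s)\<^sup>2"])
  have "\<bar>a * b\<bar> \<le> a\<^sup>2 + b\<^sup>2" for a b :: real
    using sum_squares_bound[of "\<bar>a\<bar>" "\<bar>b\<bar>"] mult_nonneg_nonneg[OF abs_ge_zero abs_ge_zero, of a b]
    unfolding abs_mult power2_abs by linarith
  then show "AE s in \<mu> x. norm (\<phi> s * \<psi> s) \<le> norm ((\<phi> s)\<^sup>2 + (\<psi> s)\<^sup>2)"
    by simp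
qed (use assms in \<open>auto simp: sq_integrable_def\<close>)

lemma sq_integrable_add:
  assumes "sq_integrable \<phi> x" "sq_integrable \<psi> x"
  shows "sq_integrable (\<lambda>s. \<phi> s + \<psi> s) x"
  using assms sq_integrable_mult[OF assms] by (auto simp: sq_integrable_def power2_sum mult.assoc)

lemma sq_integrable_diff:
  assumes "sq_integrable \<phi> x" "sq_integrable \<psi> x"
  shows "sq_integrable (\<lambda>s. \<phi> s - \<psi> s) x"
  using sq_integrable_add[OF assms(1) sq_integrable_scale[OF assms(2), of "-1"]] by simp

lemma integral_square_tendsto_0:
  assumes w: "sq_integrable w x" and [measurable]: "\<And>n. \<psi> n \<in> borel_measurable borel"
    and lim: "\<And>s. (\<lambda>n. \<psi> n s) \<longlonglongrightarrow> 0" and le: "\<And>n s. \<bar>\<psi> n s\<bar> \<le> \<bar>w s\<bar>"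
  shows "(\<lambda>n. \<integral>s. (\<psi> n s)\<^sup>2 \<partial>\<mu> x) \<longlonglongrightarrow> 0"
proof -
  have "(\<lambda>n. \<integral>s. (\<psi> n s)\<^sup>2 \<partial>\<mu> x) \<longlonglongrightarrow> (\<integral>s. 0 \<partial>\<mu> x)"
  proof (rule integral_dominated_convergence[where w = "\<lambda>s. (w s)\<^sup>2"])
    show "integrable (\<mu> x) (\<lambda>s. (w s)\<^sup>2)"
      using w by (simp add: sq_integrable_def)
    show "AE s in \<mu> x. (\<lambda>n. (\<psi> n s)\<^sup>2) \<longlonglongrightarrow> 0"
      using tendsto_power[OF lim, of _ 2] by simp
    show "AE s in \<mu> x. norm ((\<psi> n s)\<^sup>2) \<le> (w s)\<^sup>2" for n
      using abs_le_square_iff[THEN iffD1, OF le[of n]] by simp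
  qed simp_all
  then show ?thesis
    by simp
qed

text \<open>A sequence chosen once and for all. The factor 2 is the one in
  \<open>borel_measurable_implies_sequence_metric\<close>; it provides a dominating function that is
  square integrable together with \<open>\<phi>\<close>.\<close>

definition approx :: "(real \<Rightarrow> real) \<Rightarrow> nat \<Rightarrow> real \<Rightarrow> real"
  where "approx \<phi> = (SOME F. (\<forall>n. simple_function borel (F n)) \<and>
    (\<forall>s. (\<lambda>n. F n s) \<longlonglongrightarrow> \<phi> s) \<and> (\<forall>n s. \<bar>F n s\<bar> \<le> 2 * \<bar>\<phi> s\<bar>))"

lemma approx:
  assumes "\<phi> \<in> borel_measurable borel"
  shows "simple_function borel (approx \<phi> n)" "(\<lambda>n. approx \<phi> n s) \<longlonglongrightarrow> \<phi> s"
    "\<bar>approx \<phi> n s\<bar> \<le> 2 * \<bar>\<phi> s\<bar>"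
proof -
  let ?P = "\<lambda>F. (\<forall>n. simple_function borel (F n)) \<and>
    (\<forall>s. (\<lambda>n. F n s) \<longlonglongrightarrow> \<phi> s) \<and> (\<forall>n s. \<bar>F n s\<bar> \<le> 2 * \<bar>\<phi> s\<bar>)"
  have "\<exists>F. ?P F"
    using borel_measurable_implies_sequence_metric[OF assms, of 0] by (simp add: space_borel)
  then have "?P (approx \<phi>)"
    unfolding approx_def by (rule someI_ex)
  then show "simple_function borel (approx \<phi> n)" "(\<lambda>n. approx \<phi> n s) \<longlonglongrightarrow> \<phi> s"
    "\<bar>approx \<phi> n s\<bar> \<le> 2 * \<bar>\<phi> s\<bar>"
    by blast+
qed

text \<open>Meaningful only when \<open>sq_integrable \<phi> x\<close>. Independence of the chosen
  sequence is \<open>simple_calc_tendsto_calc\<close>.\<close>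

definition calc :: "(real \<Rightarrow> real) \<Rightarrow> 'h \<Rightarrow> 'h"
  where "calc \<phi> x = lim (\<lambda>n. simple_calc (approx \<phi> n) x)"

lemma simple_calc_tendsto_0:
  assumes w: "sq_integrable w x" and simple: "\<And>n. simple_function borel (\<psi> n)"
    and lim: "\<And>s. (\<lambda>n. \<psi> n s) \<longlonglongrightarrow> 0" and le: "\<And>n s. \<bar>\<psi> n s\<bar> \<le> \<bar>w s\<bar>"
  shows "(\<lambda>n. simple_calc (\<psi> n) x) \<longlonglongrightarrow> 0"
proof -
  have "(\<lambda>n. (norm (simple_calc (\<psi> n) x))\<^sup>2) \<longlonglongrightarrow> 0"
    unfolding norm_simple_calc[OF simple]
    using simple by (intro integral_square_tendsto_0[OF w _ lim le])
      (rule borel_measurable_simple_function)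
  then show ?thesis
    by (rule tendsto_norm_square_zero_cancel)
qed

text \<open>The approximants are Cauchy in L^2, the isometry makes the vectors Cauchy, and the space
  is complete.\<close>

lemma simple_calc_approx_convergent:
  assumes sq: "sq_integrable \<phi> x"
  shows "convergent (\<lambda>n. simple_calc (approx \<phi> n) x)"
proof -
  note meas [measurable] = sq_integrable_measurable[OF sq]
  note app = approx[OF meas]
  have [measurable]: "approx \<phi> n \<in> borel_measurable borel" for n
    by (rule borel_measurable_simple_function[OF app(1)])
  have sqd: "sq_integrable (\<lambda>s. approx \<phi> n s - \<phi> s) x" for n
    by (intro sq_integrable_diff sq sq_integrable_simple app(1))
  define d where "d n = (\<integral>s. (approx \<phi> n s - \<phi> s)\<^sup>2 \<partial>\<mu> x)" for n
  have "d \<longlonglongrightarrow> 0"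
    unfolding d_def
  proof (rule integral_square_tendsto_0)
    \<comment> \<open>The error is at most 2 + 1 times the modulus of \<open>\<phi>\<close>.\<close>
    show "sq_integrable (\<lambda>s. 3 * \<phi> s) x"
      by (rule sq_integrable_scale[OF sq])
    show "(\<lambda>n. approx \<phi> n s - \<phi> s) \<longlonglongrightarrow> 0" for s
      using app(2)[of s] by (simp add: LIM_zero_iff)
    show "\<bar>approx \<phi> n s - \<phi> s\<bar> \<le> \<bar>3 * \<phi> s\<bar>" for n s
      using app(3)[of n s] by (simp add: abs_mult)
  qed simp
  have le: "(norm (simple_calc (approx \<phi> m) x - simple_calc (approx \<phi> n) x))\<^sup>2 \<le> 2 * d m + 2 * d n"
    for m n
  proof -
    have "(norm (simple_calc (approx \<phi> m) x - simple_calc (approx \<phi> n) x))\<^sup>2 =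
        (\<integral>s. (approx \<phi> m s - approx \<phi> n s)\<^sup>2 \<partial>\<mu> x)"
      using norm_simple_calc[OF simple_function_diff[OF app(1) app(1)]]
      by (simp add: simple_calc_diff app(1))
    also have "\<dots> \<le> (\<integral>s. 2 * (approx \<phi> m s - \<phi> s)\<^sup>2 + 2 * (approx \<phi> n s - \<phi> s)\<^sup>2 \<partial>\<mu> x)"
    proof (rule integral_mono)
      show "integrable (\<mu> x) (\<lambda>s. (approx \<phi> m s - approx \<phi> n s)\<^sup>2)"
        using sq_integrable_simple[OF simple_function_diff[OF app(1) app(1)]]
        by (simp add: sq_integrable_def)
      show "integrable (\<mu> x) (\<lambda>s. 2 * (approx \<phi> m s - \<phi> s)\<^sup>2 + 2 * (approx \<phi> n s - \<phi> s)\<^sup>2)"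
        using sqd by (simp add: sq_integrable_def)
      \<comment> \<open>Parallelogram law: the right side exceeds the left by the square of
        \<open>a + b - 2 * c\<close>.\<close>
      have "(a - b)\<^sup>2 \<le> 2 * (a - c)\<^sup>2 + 2 * (b - c)\<^sup>2" for a b c :: real
        using zero_le_power2[of "a + b - 2 * c"] by (simp add: power2_eq_square algebra_simps)
      then show "(approx \<phi> m s - approx \<phi> n s)\<^sup>2 \<le>
          2 * (approx \<phi> m s - \<phi> s)\<^sup>2 + 2 * (approx \<phi> n s - \<phi> s)\<^sup>2" for s .
    qed
    also have "\<dots> = 2 * d m + 2 * d n"
      using sqd by (simp add: d_def sq_integrable_def)
    finally show ?thesis .
  qed
  have "Cauchy (\<lambda>n. simple_calc (approx \<phi> n) x)"
  proof (rule metric_CauchyI)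
    fix e :: real
    assume "0 < e"
    \<comment> \<open>Chosen so that \<open>2 * d m + 2 * d n\<close> stays below
      \<open>e\<^sup>2\<close>.\<close>
    then have "0 < e\<^sup>2 / 4"
      by simp
    then have "\<forall>\<^sub>F n in sequentially. d n < e\<^sup>2 / 4"
      by (rule order_tendstoD(2)[OF \<open>d \<longlonglongrightarrow> 0\<close>])
    then obtain N where N: "\<And>n. n \<ge> N \<Longrightarrow> d n < e\<^sup>2 / 4"
      unfolding eventually_sequentially by blast
    have "norm (simple_calc (approx \<phi> m) x - simple_calc (approx \<phi> n) x) < e"
      if "m \<ge> N" "n \<ge> N" for m n
      using le[of m n] N[OF that(1)] N[OF that(2)] \<open>0 < e\<close>
      by (intro power2_less_imp_less[of _ e]) auto
    then show "\<exists>N. \<forall>m\<ge>N. \<forall>n\<ge>N. dist (simple_calc (approx \<phi> m) x) (simple_calc (approx \<phi> n) x) < e"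
      by (auto simp: dist_norm)
  qed
  then show ?thesis
    by (simp add: Cauchy_convergent_iff)
qed

text \<open>Frees \<open>calc\<close> from the chosen sequence: the difference between a dominated
  simple approximation and \<open>approx \<phi>\<close> tends to \<open>0\<close> in L^2, hence so
  do the vectors.\<close>

lemma simple_calc_tendsto_calc:
  assumes sq: "sq_integrable \<phi> x" and w: "sq_integrable w x"
    and simple: "\<And>n. simple_function borel (\<psi> n)"
    and lim: "\<And>s. (\<lambda>n. \<psi> n s) \<longlonglongrightarrow> \<phi> s" and le: "\<And>n s. \<bar>\<psi> n s\<bar> \<le> \<bar>w s\<bar>"
  shows "(\<lambda>n. simple_calc (\<psi> n) x) \<longlonglongrightarrow> calc \<phi> x"
proof -
  note app = approx[OF sq_integrable_measurable[OF sq]]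
  have "(\<lambda>n. simple_calc (\<lambda>s. \<psi> n s - approx \<phi> n s) x) \<longlonglongrightarrow> 0"
  proof (rule simple_calc_tendsto_0)
    show "sq_integrable (\<lambda>s. \<bar>w s\<bar> + \<bar>2 * \<phi> s\<bar>) x"
      by (intro sq_integrable_add sq_integrable_abs sq_integrable_scale sq w)
    show "(\<lambda>n. \<psi> n s - approx \<phi> n s) \<longlonglongrightarrow> 0" for s
      using tendsto_diff[OF lim[of s] app(2)[of s]] by simp
    show "\<bar>\<psi> n s - approx \<phi> n s\<bar> \<le> \<bar>\<bar>w s\<bar> + \<bar>2 * \<phi> s\<bar>\<bar>" for n s
      using app(3)[of n s] le[of n s] by (simp add: abs_mult)
  qed (intro simple_function_diff simple app(1))
  then have "(\<lambda>n. simple_calc (\<psi> n) x - simple_calc (approx \<phi> n) x) \<longlonglongrightarrow> 0"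
    by (simp add: simple_calc_diff simple app(1))
  from tendsto_add[OF this simple_calc_approx_convergent[OF sq, unfolded convergent_LIMSEQ_iff]]
  show ?thesis
    by (simp add: calc_def)
qed

lemma approx_tendsto_calc:
  assumes "sq_integrable \<phi> x"
  shows "(\<lambda>n. simple_calc (approx \<phi> n) x) \<longlonglongrightarrow> calc \<phi> x"
  using simple_calc_approx_convergent[OF assms] by (simp add: convergent_LIMSEQ_iff calc_def)

lemma calc_simple:
  assumes "simple_function borel \<phi>"
  shows "calc \<phi> x = simple_calc \<phi> x"
proof (rule LIMSEQ_unique)
  note sq = sq_integrable_simple[OF assms]
  show "(\<lambda>n. simple_calc \<phi> x) \<longlonglongrightarrow> calc \<phi> x"
    using assms by (intro simple_calc_tendsto_calc[OF sq sq]) auto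
qed simp

lemma calc_const: "calc (\<lambda>s. c) x = c *\<^sub>R x"
  by (simp add: calc_simple simple_calc_def image_constant_conv E_UNIV)

lemma calc_indicator: "B \<in> sets borel \<Longrightarrow> calc (indicator B) x = E B x"
  by (simp add: calc_simple simple_calc_indicator)

lemma calc_add:
  assumes "sq_integrable \<phi> x" "sq_integrable \<psi> x"
  shows "calc (\<lambda>s. \<phi> s + \<psi> s) x = calc \<phi> x + calc \<psi> x"
proof (rule LIMSEQ_unique)
  note \<phi> = approx[OF sq_integrable_measurable[OF assms(1)]]
  note \<psi> = approx[OF sq_integrable_measurable[OF assms(2)]]
  show "(\<lambda>n. simple_calc (\<lambda>s. approx \<phi> n s + approx \<psi> n s) x) \<longlonglongrightarrow> calc \<phi> x + calc \<psi> x"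
    using tendsto_add[OF approx_tendsto_calc approx_tendsto_calc, OF assms]
    by (simp add: simple_calc_add \<phi> \<psi>)
  show "(\<lambda>n. simple_calc (\<lambda>s. approx \<phi> n s + approx \<psi> n s) x) \<longlonglongrightarrow> calc (\<lambda>s. \<phi> s + \<psi> s) x"
  proof (rule simple_calc_tendsto_calc)
    show "sq_integrable (\<lambda>s. \<bar>2 * \<phi> s\<bar> + \<bar>2 * \<psi> s\<bar>) x"
      by (intro sq_integrable_add sq_integrable_abs sq_integrable_scale assms)
    show "\<bar>approx \<phi> n s + approx \<psi> n s\<bar> \<le> \<bar>\<bar>2 * \<phi> s\<bar> + \<bar>2 * \<psi> s\<bar>\<bar>" for n s
      using \<phi>(3)[of n s] \<psi>(3)[of n s] by (simp add: abs_mult)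
  qed (intro sq_integrable_add assms simple_function_add tendsto_add \<phi> \<psi>)+
qed

text \<open>A simple function of the operator is a finite combination of projections, hence
  continuous, and can be applied inside the limit that defines \<open>calc \<phi> x\<close>.\<close>

lemma simple_calc_calc:
  assumes sq: "sq_integrable \<phi> x" and simple: "simple_function borel \<psi>"
    and sq': "sq_integrable (\<lambda>s. \<psi> s * \<phi> s) x"
  shows "simple_calc \<psi> (calc \<phi> x) = calc (\<lambda>s. \<psi> s * \<phi> s) x"
proof (rule LIMSEQ_unique)
  note \<phi> = approx[OF sq_integrable_measurable[OF sq]]
  note [simp] = simple_function_vimage[OF simple]
  have lim: "(\<lambda>n. E B (simple_calc (approx \<phi> n) x)) \<longlonglongrightarrow> E B (calc \<phi> x)" if "B \<in> sets borel" for B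
    by (rule bounded_linear.tendsto[OF bounded_linear_E[OF that] approx_tendsto_calc[OF sq]])
  have "(\<lambda>n. simple_calc \<psi> (simple_calc (approx \<phi> n) x)) \<longlonglongrightarrow> simple_calc \<psi> (calc \<phi> x)"
    unfolding simple_calc_def[of \<psi>] by (intro tendsto_sum tendsto_scaleR tendsto_const lim) simp
  then show "(\<lambda>n. simple_calc (\<lambda>s. \<psi> s * approx \<phi> n s) x) \<longlonglongrightarrow> simple_calc \<psi> (calc \<phi> x)"
    by (simp add: simple_calc_mult simple \<phi>)
  show "(\<lambda>n. simple_calc (\<lambda>s. \<psi> s * approx \<phi> n s) x) \<longlonglongrightarrow> calc (\<lambda>s. \<psi> s * \<phi> s) x"
  proof (rule simple_calc_tendsto_calc[OF sq'])
    show "sq_integrable (\<lambda>s. 2 * (\<psi> s * \<phi> s)) x"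
      by (rule sq_integrable_scale[OF sq'])
    show "\<bar>\<psi> s * approx \<phi> n s\<bar> \<le> \<bar>2 * (\<psi> s * \<phi> s)\<bar>" for n s
      using mult_left_mono[OF \<phi>(3)[of n s], of "\<bar>\<psi> s\<bar>"] by (simp add: abs_mult mult_ac)
  qed (intro simple_function_mult simple tendsto_mult tendsto_const \<phi>)+
qed

lemma calc_scaleR:
  assumes "sq_integrable \<phi> x"
  shows "calc (\<lambda>s. c * \<phi> s) x = c *\<^sub>R calc \<phi> x"
  using simple_calc_calc[OF assms, of "\<lambda>s. c"] assms calc_const[of c "calc \<phi> x"]
  by (simp add: sq_integrable_scale calc_simple)

lemma calc_diff:
  assumes "sq_integrable \<phi> x" "sq_integrable \<psi> x"
  shows "calc (\<lambda>s. \<phi> s - \<psi> s) x = calc \<phi> x - calc \<psi> x"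
  using calc_add[OF assms(1) sq_integrable_scale[OF assms(2), of "-1"]] calc_scaleR[OF assms(2), of "-1"]
  by simp

lemma E_calc:
  assumes "sq_integrable \<phi> x" "B \<in> sets borel"
  shows "E B (calc \<phi> x) = calc (\<lambda>s. indicator B s * \<phi> s) x"
proof -
  have "sq_integrable (\<lambda>s. indicator B s * \<phi> s) x"
    using assms(2) sq_integrable_measurable[OF assms(1)]
    by (intro sq_integrable_mono[OF assms(1)]) (auto simp: indicator_def)
  then show ?thesis
    using simple_calc_calc[OF assms(1), of "indicator B"] assms(2)
    by (simp add: simple_calc_indicator)
qed

lemma norm_calc:
  assumes sq: "sq_integrable \<phi> x"
  shows "(norm (calc \<phi> x))\<^sup>2 = (\<integral>s. (\<phi> s)\<^sup>2 \<partial>\<mu> x)"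
proof (rule LIMSEQ_unique)
  note meas [measurable] = sq_integrable_measurable[OF sq]
  note \<phi> = approx[OF meas]
  show "(\<lambda>n. (norm (simple_calc (approx \<phi> n) x))\<^sup>2) \<longlonglongrightarrow> (norm (calc \<phi> x))\<^sup>2"
    by (intro tendsto_intros approx_tendsto_calc sq)
  show "(\<lambda>n. (norm (simple_calc (approx \<phi> n) x))\<^sup>2) \<longlonglongrightarrow> (\<integral>s. (\<phi> s)\<^sup>2 \<partial>\<mu> x)"
    unfolding norm_simple_calc[OF \<phi>(1)]
  proof (rule integral_dominated_convergence)
    show "integrable (\<mu> x) (\<lambda>s. (2 * \<phi> s)\<^sup>2)"
      using sq_integrable_scale[OF sq, of 2] by (simp only: sq_integrable_def)
    show "AE s in \<mu> x. (\<lambda>n. (approx \<phi> n s)\<^sup>2) \<longlonglongrightarrow> (\<phi> s)\<^sup>2"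
      by (intro AE_I2 tendsto_power \<phi>)
    show "AE s in \<mu> x. norm ((approx \<phi> n s)\<^sup>2) \<le> (2 * \<phi> s)\<^sup>2" for n
    proof (rule AE_I2)
      fix s
      have "\<bar>approx \<phi> n s\<bar> \<le> \<bar>2 * \<phi> s\<bar>"
        using \<phi>(3)[of n s] by (simp add: abs_mult)
      then show "norm ((approx \<phi> n s)\<^sup>2) \<le> (2 * \<phi> s)\<^sup>2"
        unfolding abs_le_square_iff by simp
    qed
    show "(\<lambda>s. (approx \<phi> n s)\<^sup>2) \<in> borel_measurable (\<mu> x)" for n
      using borel_measurable_simple_function[OF \<phi>(1)[of n]] by simp
  qed simp
qed

lemma cinner_calc_self:
  assumes sq: "sq_integrable \<phi> x"
  shows "cinner (calc \<phi> x) x = complex_of_real (\<integral>s. \<phi> s \<partial>\<mu> x)"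
proof (rule LIMSEQ_unique)
  note meas [measurable] = sq_integrable_measurable[OF sq]
  note \<phi> = approx[OF meas]
  show "(\<lambda>n. cinner (simple_calc (approx \<phi> n) x) x) \<longlonglongrightarrow> cinner (calc \<phi> x) x"
    by (intro cinner.tendsto tendsto_const approx_tendsto_calc sq)
  show "(\<lambda>n. cinner (simple_calc (approx \<phi> n) x) x) \<longlonglongrightarrow> complex_of_real (\<integral>s. \<phi> s \<partial>\<mu> x)"
    unfolding cinner_simple_calc_self[OF \<phi>(1)]
  proof (intro tendsto_of_real integral_dominated_convergence)
    show "integrable (\<mu> x) (\<lambda>s. 2 * \<bar>\<phi> s\<bar>)"
      using sq_integrable_mult[OF sq sq_integrable_const[of 1]] by simp
    show "AE s in \<mu> x. (\<lambda>n. approx \<phi> n s) \<longlonglongrightarrow> \<phi> s"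
      by (intro AE_I2 \<phi>)
    show "AE s in \<mu> x. norm (approx \<phi> n s) \<le> 2 * \<bar>\<phi> s\<bar>" for n
      using \<phi>(3)[of n] by simp
    show "approx \<phi> n \<in> borel_measurable (\<mu> x)" for n
      using borel_measurable_simple_function[OF \<phi>(1)[of n]] by simp
  qed simp
qed

lemma calc_commute:
  assumes "sq_integrable \<phi> x" "sq_integrable \<phi> y"
  shows "cinner (calc \<phi> x) y = cinner x (calc \<phi> y)"
proof (rule LIMSEQ_unique)
  note \<phi> = approx[OF sq_integrable_measurable[OF assms(1)]]
  show "(\<lambda>n. cinner (simple_calc (approx \<phi> n) x) y) \<longlonglongrightarrow> cinner (calc \<phi> x) y"
    by (intro cinner.tendsto tendsto_const approx_tendsto_calc assms)
  show "(\<lambda>n. cinner (simple_calc (approx \<phi> n) x) y) \<longlonglongrightarrow> cinner x (calc \<phi> y)"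
    unfolding simple_calc_commute[OF \<phi>(1)]
    by (intro cinner.tendsto tendsto_const approx_tendsto_calc assms)
qed

text \<open>A projection applied to \<open>calc \<phi> x\<close> multiplies the function by an
  indicator, and the isometry turns the squared norm into an integral over \<open>B\<close>. Domain
  questions about \<open>calc \<phi> x\<close> thereby become integrability questions for
  \<open>\<mu> x\<close>.\<close>

lemma scalar_measure_calc:
  assumes sq: "sq_integrable \<phi> x"
  shows "\<mu> (calc \<phi> x) = density (\<mu> x) (\<lambda>s. ennreal ((\<phi> s)\<^sup>2))"
proof (rule measure_eqI)
  note meas [measurable] = sq_integrable_measurable[OF sq]
  fix B
  assume "B \<in> sets (\<mu> (calc \<phi> x))"
  then have B [measurable]: "B \<in> sets borel"
    by simp
  have sqB: "sq_integrable (\<lambda>s. indicator B s * \<phi> s) x"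
    by (intro sq_integrable_mono[OF sq]) (auto simp: indicator_def)
  have "emeasure (\<mu> (calc \<phi> x)) B = ennreal (\<integral>s. (indicator B s * \<phi> s)\<^sup>2 \<partial>\<mu> x)"
    by (simp add: emeasure_scalar_measure E_calc sq norm_calc sqB)
  also have "\<dots> = (\<integral>\<^sup>+s. ennreal ((indicator B s * \<phi> s)\<^sup>2) \<partial>\<mu> x)"
    using sqB by (intro nn_integral_eq_integral[symmetric]) (auto simp: sq_integrable_def)
  also have "\<dots> = (\<integral>\<^sup>+s. ennreal ((\<phi> s)\<^sup>2) * indicator B s \<partial>\<mu> x)"
    by (intro nn_integral_cong) (simp add: indicator_def)
  also have "\<dots> = emeasure (density (\<mu> x) (\<lambda>s. ennreal ((\<phi> s)\<^sup>2))) B"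
    by (rule emeasure_density[symmetric]) simp_all
  finally show "emeasure (\<mu> (calc \<phi> x)) B =
      emeasure (density (\<mu> x) (\<lambda>s. ennreal ((\<phi> s)\<^sup>2))) B" .
qed simp

lemma sq_integrable_calc_iff:
  assumes sq: "sq_integrable \<rho> x" and [measurable]: "\<phi> \<in> borel_measurable borel"
  shows "sq_integrable \<phi> (calc \<rho> x) \<longleftrightarrow> sq_integrable (\<lambda>s. \<phi> s * \<rho> s) x"
proof -
  note meas [measurable] = sq_integrable_measurable[OF sq]
  have "integrable (\<mu> (calc \<rho> x)) (\<lambda>s. (\<phi> s)\<^sup>2) \<longleftrightarrow> integrable (\<mu> x) (\<lambda>s. (\<rho> s)\<^sup>2 *\<^sub>R (\<phi> s)\<^sup>2)"
    unfolding scalar_measure_calc[OF sq] by (rule integrable_density) simp_all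
  then show ?thesis
    by (simp add: sq_integrable_def power_mult_distrib mult.commute)
qed

text \<open>For simple outer functions this is \<open>simple_calc_calc\<close>. Along
  \<open>approx \<phi>\<close> the left side converges because \<open>calc \<rho> x\<close> lies in
  the domain of \<open>\<phi>\<close>, the right side by the isometry and dominated
  convergence.\<close>

lemma calc_calc:
  assumes sq: "sq_integrable \<rho> x" and meas [measurable]: "\<phi> \<in> borel_measurable borel"
    and sq': "sq_integrable (\<lambda>s. \<phi> s * \<rho> s) x"
  shows "calc \<phi> (calc \<rho> x) = calc (\<lambda>s. \<phi> s * \<rho> s) x"
proof (rule LIMSEQ_unique)
  note [measurable] = sq_integrable_measurable[OF sq]
  note \<phi> = approx[OF meas]
  have [measurable]: "approx \<phi> n \<in> borel_measurable borel" for n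
    by (rule borel_measurable_simple_function[OF \<phi>(1)])
  have bound: "\<bar>approx \<phi> n s * \<rho> s\<bar> \<le> \<bar>2 * (\<phi> s * \<rho> s)\<bar>" for n s
    using mult_right_mono[OF \<phi>(3)[of n s], of "\<bar>\<rho> s\<bar>"] by (simp add: abs_mult mult_ac)
  have sqn: "sq_integrable (\<lambda>s. approx \<phi> n s * \<rho> s) x" for n
    by (rule sq_integrable_mono[OF sq_integrable_scale[OF sq', of 2] _ bound]) simp
  have "sq_integrable \<phi> (calc \<rho> x)"
    using sq' by (simp add: sq_integrable_calc_iff[OF sq])
  then have "(\<lambda>n. simple_calc (approx \<phi> n) (calc \<rho> x)) \<longlonglongrightarrow> calc \<phi> (calc \<rho> x)"
    by (rule approx_tendsto_calc)
  then show "(\<lambda>n. calc (\<lambda>s. approx \<phi> n s * \<rho> s) x) \<longlonglongrightarrow> calc \<phi> (calc \<rho> x)"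
    by (simp add: simple_calc_calc[OF sq \<phi>(1) sqn])
  have "(\<lambda>n. \<integral>s. (approx \<phi> n s * \<rho> s - \<phi> s * \<rho> s)\<^sup>2 \<partial>\<mu> x) \<longlonglongrightarrow> 0"
  proof (rule integral_square_tendsto_0)
    show "sq_integrable (\<lambda>s. 3 * (\<phi> s * \<rho> s)) x"
      by (rule sq_integrable_scale[OF sq'])
    show "(\<lambda>n. approx \<phi> n s * \<rho> s - \<phi> s * \<rho> s) \<longlonglongrightarrow> 0" for s
      by (rule LIM_zero[OF tendsto_mult_right[OF \<phi>(2)]])
    show "\<bar>approx \<phi> n s * \<rho> s - \<phi> s * \<rho> s\<bar> \<le> \<bar>3 * (\<phi> s * \<rho> s)\<bar>" for n s
      using bound[of n s] by arith
  qed simp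
  then have "(\<lambda>n. (norm (calc (\<lambda>s. approx \<phi> n s * \<rho> s) x - calc (\<lambda>s. \<phi> s * \<rho> s) x))\<^sup>2) \<longlonglongrightarrow> 0"
    unfolding calc_diff[OF sqn sq', symmetric] norm_calc[OF sq_integrable_diff[OF sqn sq']] .
  then show "(\<lambda>n. calc (\<lambda>s. approx \<phi> n s * \<rho> s) x) \<longlonglongrightarrow> calc (\<lambda>s. \<phi> s * \<rho> s) x"
    by (rule LIM_zero_cancel[OF tendsto_norm_square_zero_cancel])
qed

text \<open>Fatou's lemma as a domain criterion: a uniform bound on the approximating vectors places
  \<open>x\<close> in the domain of the limit function.\<close>

lemma sq_integrable_limit:
  assumes sq: "\<And>n. sq_integrable (\<psi> n) x" and meas [measurable]: "\<phi> \<in> borel_measurable borel"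
    and lim: "\<And>s. (\<lambda>n. \<psi> n s) \<longlonglongrightarrow> \<phi> s" and le: "\<And>n. norm (calc (\<psi> n) x) \<le> C"
  shows "sq_integrable \<phi> x"
proof -
  note [measurable] = sq_integrable_measurable[OF sq]
  have bound: "(\<integral>\<^sup>+s. ennreal ((\<psi> n s)\<^sup>2) \<partial>\<mu> x) \<le> ennreal (C\<^sup>2)" for n
  proof -
    have "(\<integral>\<^sup>+s. ennreal ((\<psi> n s)\<^sup>2) \<partial>\<mu> x) = ennreal (\<integral>s. (\<psi> n s)\<^sup>2 \<partial>\<mu> x)"
      using sq by (intro nn_integral_eq_integral) (auto simp: sq_integrable_def)
    also have "\<dots> \<le> ennreal (C\<^sup>2)"
      unfolding norm_calc[OF sq, symmetric] by (intro ennreal_leI power_mono le norm_ge_zero)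
    finally show ?thesis .
  qed
  have "(\<integral>\<^sup>+s. ennreal ((\<phi> s)\<^sup>2) \<partial>\<mu> x) = (\<integral>\<^sup>+s. liminf (\<lambda>n. ennreal ((\<psi> n s)\<^sup>2)) \<partial>\<mu> x)"
    by (intro nn_integral_cong lim_imp_Liminf[symmetric] tendsto_ennrealI tendsto_power lim) simp
  also have "\<dots> \<le> liminf (\<lambda>n. \<integral>\<^sup>+s. ennreal ((\<psi> n s)\<^sup>2) \<partial>\<mu> x)"
    by (rule nn_integral_liminf) simp
  also have "\<dots> \<le> ennreal (C\<^sup>2)"
    using bound by (intro Liminf_le eventuallyI) auto
  also have "\<dots> < \<infinity>"
    by simp
  finally have "integrable (\<mu> x) (\<lambda>s. (\<phi> s)\<^sup>2)"
    by (intro integrableI_nonneg) simp_all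
  then show ?thesis
    by (simp add: sq_integrable_def)
qed

text \<open>The scalar measure is quadratic in the vector, so linearity of the domain takes an
  argument. Simple functions act additively, so the approximants at \<open>x + y\<close> converge;
  they are therefore bounded, and \<open>sq_integrable_limit\<close> applies.\<close>

lemma calc_add_right_sq_integrable:
  assumes "sq_integrable \<phi> x" "sq_integrable \<phi> y"
  shows sq_integrable_add_right: "sq_integrable \<phi> (x + y)"
    and calc_add_right: "calc \<phi> (x + y) = calc \<phi> x + calc \<phi> y"
proof -
  note meas = sq_integrable_measurable[OF assms(1)]
  note \<phi> = approx[OF meas]
  have lim: "(\<lambda>n. simple_calc (approx \<phi> n) (x + y)) \<longlonglongrightarrow> calc \<phi> x + calc \<phi> y"
    unfolding simple_calc_add_right[OF \<phi>(1)] by (intro tendsto_add approx_tendsto_calc assms)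
  then obtain C where "\<And>n. norm (simple_calc (approx \<phi> n) (x + y)) \<le> C"
    using convergent_imp_Bseq[OF convergentI] by (meson BseqE)
  then show sq: "sq_integrable \<phi> (x + y)"
    by (intro sq_integrable_limit[OF sq_integrable_simple meas, of "approx \<phi>"]) (simp_all add: \<phi> calc_simple)
  show "calc \<phi> (x + y) = calc \<phi> x + calc \<phi> y"
    by (rule LIMSEQ_unique[OF approx_tendsto_calc[OF sq] lim])
qed

lemma calc_scaleC_right_sq_integrable:
  assumes "sq_integrable \<phi> x"
  shows sq_integrable_scaleC_right: "sq_integrable \<phi> (a *\<^sub>C x)"
    and calc_scaleC_right: "calc \<phi> (a *\<^sub>C x) = a *\<^sub>C calc \<phi> x"
proof -
  note meas = sq_integrable_measurable[OF assms(1)]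
  note \<phi> = approx[OF meas]
  have lim: "(\<lambda>n. simple_calc (approx \<phi> n) (a *\<^sub>C x)) \<longlonglongrightarrow> a *\<^sub>C calc \<phi> x"
    unfolding simple_calc_scaleC_right[OF \<phi>(1)] by (intro tendsto_scaleC approx_tendsto_calc assms)
  then obtain C where "\<And>n. norm (simple_calc (approx \<phi> n) (a *\<^sub>C x)) \<le> C"
    using convergent_imp_Bseq[OF convergentI] by (meson BseqE)
  then show sq: "sq_integrable \<phi> (a *\<^sub>C x)"
    by (intro sq_integrable_limit[OF sq_integrable_simple meas, of "approx \<phi>"]) (simp_all add: \<phi> calc_simple)
  show "calc \<phi> (a *\<^sub>C x) = a *\<^sub>C calc \<phi> x"
    by (rule LIMSEQ_unique[OF approx_tendsto_calc[OF sq] lim])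
qed

lemma calc_minus_right_sq_integrable:
  assumes "sq_integrable \<phi> x"
  shows sq_integrable_minus_right: "sq_integrable \<phi> (- x)"
    and calc_minus_right: "calc \<phi> (- x) = - calc \<phi> x"
proof -
  have "- y = (- 1) *\<^sub>C y" for y :: 'h
    using scaleR_scaleC[of "-1" y] by simp
  then show "sq_integrable \<phi> (- x)" "calc \<phi> (- x) = - calc \<phi> x"
    using calc_scaleC_right_sq_integrable[OF assms, of "-1"] by simp_all
qed

lemma calc_diff_right_sq_integrable:
  assumes "sq_integrable \<phi> x" "sq_integrable \<phi> y"
  shows sq_integrable_diff_right: "sq_integrable \<phi> (x - y)"
    and calc_diff_right: "calc \<phi> (x - y) = calc \<phi> x - calc \<phi> y"
  using calc_add_right_sq_integrable[OF assms(1) sq_integrable_minus_right[OF assms(2)]]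
    calc_minus_right[OF assms(2)] by simp_all

lemma E_tendsto:
  assumes B: "\<And>n. B n \<in> sets borel" and ev: "\<And>s. \<forall>\<^sub>F n in sequentially. s \<in> B n"
  shows "(\<lambda>n. E (B n) x) \<longlonglongrightarrow> x"
proof -
  have "(\<lambda>n. simple_calc (indicator (B n)) x) \<longlonglongrightarrow> calc (\<lambda>s. 1) x"
  proof (rule simple_calc_tendsto_calc[OF sq_integrable_const sq_integrable_const])
    show "(\<lambda>n. indicator (B n) s) \<longlonglongrightarrow> (1::real)" for s
      using ev[of s] by (intro tendsto_eventually) (auto elim: eventually_mono)
    show "simple_function borel (indicator (B n) :: real \<Rightarrow> real)" for n
      using B by (rule simple_function_indicator)
    show "\<bar>indicator (B n) s\<bar> \<le> \<bar>1::real\<bar>" for n s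
      by (simp add: indicator_def)
  qed
  then show ?thesis
    by (simp add: simple_calc_indicator B calc_const)
qed

text \<open>\<open>E B x\<close> is \<open>calc (indicator B) x\<close>, so only the values of
  \<open>\<phi>\<close> on \<open>B\<close> count.\<close>

lemma sq_integrable_E:
  assumes [measurable]: "B \<in> sets borel" and meas [measurable]: "\<phi> \<in> borel_measurable borel"
    and le: "\<And>s. s \<in> B \<Longrightarrow> \<bar>\<phi> s\<bar> \<le> C"
  shows "sq_integrable \<phi> (E B x)"
proof -
  have "sq_integrable (\<lambda>s. \<phi> s * indicator B s) x"
    using le by (intro sq_integrable_bounded[of _ "\<bar>C\<bar>"])
      (auto simp: indicator_def intro: order_trans[OF _ abs_ge_self])
  then have "sq_integrable \<phi> (calc (indicator B) x)"
    by (subst sq_integrable_calc_iff) (simp_all add: sq_integrable_simple)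
  then show ?thesis
    by (simp add: calc_indicator)
qed

section \<open>Identification of \<open>spectral_integral\<close> with \<open>calc\<close>\<close>

lemma spectral_integral_dom_iff:
  assumes "(\<lambda>s. indicator S s * g s) \<in> borel_measurable borel"
  shows "x \<in> spectral_integral_dom E S g \<longleftrightarrow> sq_integrable (\<lambda>s. indicator S s * g s) x"
proof -
  have "(\<integral>\<^sup>+s\<in>S. ennreal ((g s)\<^sup>2) \<partial>\<mu> x) = (\<integral>\<^sup>+s. ennreal (norm ((indicator S s * g s)\<^sup>2)) \<partial>\<mu> x)"
    by (intro nn_integral_cong) (simp add: indicator_def)
  then show ?thesis
    using assms by (simp add: spectral_integral_dom_def sq_integrable_def integrable_iff_bounded)
qed

text \<open>The vectors are cut off to sets where the integrand is bounded. Density is what makes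
  the definite description in \<open>spectral_integral\<close> determinate.\<close>

lemma spectral_integral_dom_dense:
  assumes [measurable]: "(\<lambda>s. indicator S s * g s) \<in> borel_measurable borel"
  shows "closure (spectral_integral_dom E S g) = UNIV"
proof -
  have "x \<in> closure (spectral_integral_dom E S g)" for x
  proof -
    define B where "B n = {s. \<bar>indicator S s * g s\<bar> \<le> real n}" for n
    have B: "B n \<in> sets borel" for n
      unfolding B_def by measurable
    have "(\<lambda>n. E (B n) x) \<longlonglongrightarrow> x"
    proof (rule E_tendsto[OF B])
      show "\<forall>\<^sub>F n in sequentially. s \<in> B n" for s
        unfolding B_def using eventually_ge_at_top[of "nat \<lceil>\<bar>indicator S s * g s\<bar>\<rceil>"]
        by eventually_elim (simp add: nat_ceiling_le_eq)
    qed
    moreover have "E (B n) x \<in> spectral_integral_dom E S g" for n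
      unfolding spectral_integral_dom_iff[OF assms]
      by (rule sq_integrable_E[OF B assms, of _ "real n"]) (simp add: B_def)
    ultimately show ?thesis
      unfolding closure_sequential by (intro exI[of _ "\<lambda>n. E (B n) x"] conjI allI)
  qed
  then show ?thesis
    by auto
qed

text \<open>Polarization of the quadratic form of \<open>calc\<close>, which is real by
  \<open>cinner_calc_self\<close>. All four vectors in the formula, including those with
  \<open>\<i> *\<^sub>C y\<close>, must lie in the domain; its linearity enters here.\<close>

lemma spectral_form_eq:
  assumes x: "sq_integrable (\<lambda>s. indicator S s * g s) x"
    and y: "sq_integrable (\<lambda>s. indicator S s * g s) y"
  shows "spectral_form E S g x y = cinner (calc (\<lambda>s. indicator S s * g s) x) y"
proof -
  let ?g = "\<lambda>s. indicator S s * g s"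
  note iy = sq_integrable_scaleC_right[OF y, of \<i>]
  have Q: "complex_of_real (LINT s:S|\<mu> z. g s) = cinner (calc ?g z) z" if "sq_integrable ?g z" for z
    by (simp add: cinner_calc_self[OF that] set_lebesgue_integral_def)
  show ?thesis
    unfolding spectral_form_def Let_def Q[OF sq_integrable_add_right[OF x y]]
      Q[OF sq_integrable_diff_right[OF x y]] Q[OF sq_integrable_add_right[OF x iy]]
      Q[OF sq_integrable_diff_right[OF x iy]] calc_add_right[OF x y] calc_diff_right[OF x y]
      calc_add_right[OF x iy] calc_diff_right[OF x iy] calc_scaleC_right[OF y]
      cinner.add_left cinner.add_right cinner.diff_left cinner.diff_right
      cinner_scaleC_left cinner_scaleC_right complex_cnj_i
    by (simp only: right_diff_distrib distrib_left mult.assoc[symmetric] i_squared) simp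
qed

text \<open>The bridge from the definitions to \<open>calc\<close>: through it \<open>A\<close>,
  \<open>f(A)\<close> and the square root of \<open>A\<close> are all handled as \<open>calc\<close>
  of a Borel function on the line.\<close>

lemma spectral_integral_eq:
  assumes x: "sq_integrable (\<lambda>s. indicator S s * g s) x"
  shows "spectral_integral E S g x = calc (\<lambda>s. indicator S s * g s) x"
proof -
  note meas = sq_integrable_measurable[OF x]
  show ?thesis
    unfolding spectral_integral_def
  proof (rule the_equality)
    show eq: "\<forall>y\<in>spectral_integral_dom E S g.
        cinner (calc (\<lambda>s. indicator S s * g s) x) y = spectral_form E S g x y"
      by (simp add: spectral_integral_dom_iff[OF meas] spectral_form_eq[OF x])
    show "h = calc (\<lambda>s. indicator S s * g s) x"
      if "\<forall>y\<in>spectral_integral_dom E S g. cinner h y = spectral_form E S g x y" for h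
      using that eq by (intro dense_cinner_eq_imp_eq[OF spectral_integral_dom_dense[OF meas]]) simp
  qed
qed

section \<open>Norm bounds, and boundedness of everywhere defined functions of the operator\<close>

lemma norm_calc_mono:
  assumes sq: "sq_integrable \<psi> x" and meas: "\<phi> \<in> borel_measurable borel"
    and le: "\<And>s. \<bar>\<phi> s\<bar> \<le> \<bar>\<psi> s\<bar>"
  shows "norm (calc \<phi> x) \<le> norm (calc \<psi> x)"
proof -
  note sq' = sq_integrable_mono[OF sq meas le]
  have "(norm (calc \<phi> x))\<^sup>2 \<le> (norm (calc \<psi> x))\<^sup>2"
    unfolding norm_calc[OF sq] norm_calc[OF sq']
  proof (rule integral_mono)
    show "(\<phi> s)\<^sup>2 \<le> (\<psi> s)\<^sup>2" for s
      using le by (simp only: abs_le_square_iff)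
  qed (use sq sq' in \<open>simp_all add: sq_integrable_def\<close>)
  then show ?thesis
    by (rule power2_le_imp_le) simp
qed

lemma norm_calc_bounded_le:
  assumes "\<phi> \<in> borel_measurable borel" "\<And>s. \<bar>\<phi> s\<bar> \<le> C"
  shows "norm (calc \<phi> x) \<le> C * norm x"
proof -
  have "0 \<le> C"
    using assms(2)[of 0] by simp
  then show ?thesis
    using norm_calc_mono[OF sq_integrable_const[of C] assms(1), of x] assms(2)
    by (simp add: calc_const)
qed

lemma E_zero_vector: "B \<in> sets borel \<Longrightarrow> E B 0 = 0"
  using norm_E_le[of B 0] by simp

lemma E_null_subset:
  assumes "B \<in> sets borel" "C \<in> sets borel" "B \<subseteq> C" "E C x = 0"
  shows "E B x = 0"
proof -
  have "E B x = E B (E C x)"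
    using assms(1-3) by (simp add: E_E Int_absorb2)
  then show ?thesis
    using assms by (simp add: E_zero_vector)
qed

text \<open>If \<open>\<phi>\<close> were unbounded, infinitely many of the dyadic level sets \<open>G k\<close> would carry a unit
  vector \<open>e k\<close>, and the \<open>G k\<close>-components of \<open>calc \<phi> (\<Sum>k. e k / 2 ^ k)\<close> would not tend to \<open>0\<close>.\<close>

lemma sq_integrable_everywhere_imp_bounded:
  assumes meas [measurable]: "\<phi> \<in> borel_measurable borel" and sq: "\<And>x. sq_integrable \<phi> x"
  shows "\<exists>C. \<forall>x. E {s. C < \<bar>\<phi> s\<bar>} x = 0"
proof (rule ccontr)
  assume unbounded: "\<not> ?thesis"
  define G where "G k = {s. 2 ^ k \<le> \<bar>\<phi> s\<bar> \<and> \<bar>\<phi> s\<bar> < 2 ^ Suc k}" for k :: nat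
  have G [measurable, simp]: "G k \<in> sets borel" for k
    unfolding G_def by measurable
  have G_disjoint: "G j \<inter> G k = {}" if "j \<noteq> k" for j k
  proof -
    have "G j \<inter> G k = {}" if "j < k" for j k
    proof -
      have "(2::real) ^ Suc j \<le> 2 ^ k"
        using that by (intro power_increasing) simp_all
      then show ?thesis
        by (auto simp: G_def)
    qed
    then show ?thesis
      using that by (metis Int_commute linorder_neqE_nat)
  qed
  \<comment> \<open>Otherwise the set where the modulus of \<open>\<phi>\<close> exceeds
    \<open>2 ^ N\<close> is covered by null sets \<open>G k\<close>, and \<open>2 ^ N\<close> would
    be an essential bound.\<close>
  have infinite: "\<exists>k\<ge>N. \<exists>x. E (G k) x \<noteq> 0" for N
  proof (rule ccontr)
    assume "\<not> (\<exists>k\<ge>N. \<exists>x. E (G k) x \<noteq> 0)"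
    then have null: "E (G k) x = 0" if "N \<le> k" for k x
      using that by blast
    obtain x where x: "E {s. 2 ^ N < \<bar>\<phi> s\<bar>} x \<noteq> 0"
      using unbounded by blast
    have "(\<Union>k\<in>{N..}. G k) \<in> null_sets (\<mu> x)"
      by (rule null_sets_UN') (auto simp: null_sets_def emeasure_scalar_measure null)
    moreover have "{s. 2 ^ N < \<bar>\<phi> s\<bar>} \<subseteq> (\<Union>k\<in>{N..}. G k)"
    proof
      fix s
      assume "s \<in> {s. 2 ^ N < \<bar>\<phi> s\<bar>}"
      then have s: "2 ^ N < \<bar>\<phi> s\<bar>"
        by simp
      obtain n where n: "\<bar>\<phi> s\<bar> < 2 ^ n"
        using real_arch_pow[of 2 "\<bar>\<phi> s\<bar>"] by auto
      \<comment> \<open>The least power of 2 above the value locates its dyadic level. The exponent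
        exceeds \<open>N\<close>, so it is a successor and the level is its predecessor.\<close>
      define m where "m = (LEAST n. \<bar>\<phi> s\<bar> < 2 ^ n)"
      have m: "\<bar>\<phi> s\<bar> < 2 ^ m"
        unfolding m_def by (rule LeastI[of _ n]) (rule n)
      then have "(2::real) ^ N < 2 ^ m"
        using s by linarith
      then have "N < m"
        by (simp add: power_strict_increasing_iff)
      then obtain k where k: "m = Suc k" "N \<le> k"
        by (cases m) auto
      have "\<not> \<bar>\<phi> s\<bar> < 2 ^ k"
        using not_less_Least[of k "\<lambda>n. \<bar>\<phi> s\<bar> < 2 ^ n"] k by (simp add: m_def)
      then have "s \<in> G k"
        using m by (simp add: G_def k(1))
      then show "s \<in> (\<Union>k\<in>{N..}. G k)"
        using k(2) by blast
    qed
    ultimately have "{s. 2 ^ N < \<bar>\<phi> s\<bar>} \<in> null_sets (\<mu> x)"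
      using null_sets_subset[of "\<Union>k\<in>{N..}. G k" "\<mu> x" "{s. 2 ^ N < \<bar>\<phi> s\<bar>}"] by simp
    then show False
      using x by (simp add: null_sets_def emeasure_scalar_measure)
  qed
  \<comment> \<open>A unit vector where the range of \<open>E (G k)\<close> is nontrivial and
    \<open>0\<close> elsewhere, so the series below can run over all \<open>k\<close> instead of a
    subsequence.\<close>
  have "\<exists>e. E (G k) e = e \<and> norm e \<le> 1 \<and> ((\<exists>x. E (G k) x \<noteq> 0) \<longrightarrow> norm e = 1)" for k
  proof (cases "\<exists>x. E (G k) x \<noteq> 0")
    case True
    then obtain x where "E (G k) x \<noteq> 0"
      by blast
    then show ?thesis
      by (intro exI[of _ "(1 / norm (E (G k) x)) *\<^sub>R E (G k) x"]) (simp add: E_scaleR E_E)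
  next
    case False
    then show ?thesis
      by (intro exI[of _ 0]) (simp add: E_zero_vector)
  qed
  then obtain e where e: "\<And>k. E (G k) (e k) = e k" "\<And>k. norm (e k) \<le> 1"
    "\<And>k x. E (G k) x \<noteq> 0 \<Longrightarrow> norm (e k) = 1"
    by metis
  define y where "y = (\<Sum>k. (1 / 2) ^ k *\<^sub>R e k)"
  have "summable (\<lambda>k. (1 / 2) ^ k *\<^sub>R e k)"
  proof (rule summable_comparison_test')
    show "summable (\<lambda>k. (1 / 2) ^ k :: real)"
      by (rule summable_geometric) simp
    show "norm ((1 / 2) ^ k *\<^sub>R e k) \<le> (1 / 2) ^ k" for k
      using mult_left_mono[OF e(2), of "(1 / 2) ^ k" k] by simp
  qed
  then have y: "(\<lambda>k. (1 / 2) ^ k *\<^sub>R e k) sums y"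
    unfolding y_def by (rule summable_sums)
  have E_y: "E (G k) y = (1 / 2) ^ k *\<^sub>R e k" for k
  proof (rule sums_unique2)
    show "(\<lambda>j. E (G k) ((1 / 2) ^ j *\<^sub>R e j)) sums E (G k) y"
      by (rule bounded_linear.sums[OF bounded_linear_E y]) simp
    have "E (G k) (e j) = 0" if "j \<noteq> k" for j
      using E_E[of "G k" "G j" "e j"] G_disjoint[of k j] that by (simp add: e(1) E_empty)
    then have "E (G k) ((1 / 2) ^ j *\<^sub>R e j) = (if j = k then (1 / 2) ^ j *\<^sub>R e j else 0)" for j
      by (simp add: E_scaleR e(1))
    then show "(\<lambda>j. E (G k) ((1 / 2) ^ j *\<^sub>R e j)) sums ((1 / 2) ^ k *\<^sub>R e k)"
      using sums_single[of k "\<lambda>j. (1 / 2) ^ j *\<^sub>R e j"] by presburger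
  qed
  \<comment> \<open>On \<open>G k\<close> the modulus of \<open>\<phi>\<close> is at least
    \<open>2 ^ k\<close>, which cancels the weight of \<open>e k\<close> in
    \<open>y\<close>.\<close>
  have ge: "norm (e k) \<le> norm (E (G k) (calc \<phi> y))" for k
  proof -
    have le: "\<bar>2 ^ k * indicator (G k) s\<bar> \<le> \<bar>indicator (G k) s * \<phi> s\<bar>" for s
      by (simp add: indicator_def G_def)
    have "norm (calc (\<lambda>s. 2 ^ k * indicator (G k) s) y) \<le> norm (calc (\<lambda>s. indicator (G k) s * \<phi> s) y)"
    proof (rule norm_calc_mono[OF _ _ le])
      show "sq_integrable (\<lambda>s. indicator (G k) s * \<phi> s) y"
        by (rule sq_integrable_mono[OF sq]) (simp_all add: indicator_def)
    qed simp
    moreover have "calc (\<lambda>s. 2 ^ k * indicator (G k) s) y = 2 ^ k *\<^sub>R calc (indicator (G k)) y"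
      by (intro calc_scaleR sq_integrable_simple simple_function_indicator) simp
    ultimately show ?thesis
      by (simp add: calc_indicator E_y E_calc sq power_divide)
  qed
  \<comment> \<open>The \<open>G k\<close> are disjoint, so countable additivity makes the
    components of the one vector \<open>calc \<phi> y\<close> summable, although infinitely many of
    them have norm at least \<open>1\<close>.\<close>
  have "summable (\<lambda>k. E (G k) (calc \<phi> y))"
    using E_sums[of G "calc \<phi> y", THEN sums_summable] G_disjoint
    by (simp add: disjoint_family_on_def image_subset_iff)
  then have "(\<lambda>k. norm (E (G k) (calc \<phi> y))) \<longlonglongrightarrow> 0"
    by (rule tendsto_norm_zero[OF summable_LIMSEQ_zero])
  then have "\<forall>\<^sub>F k in sequentially. norm (E (G k) (calc \<phi> y)) < 1"
    by (rule order_tendstoD(2)) simp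
  then obtain N where N: "\<And>k. k \<ge> N \<Longrightarrow> norm (E (G k) (calc \<phi> y)) < 1"
    unfolding eventually_sequentially by blast
  obtain k x where "k \<ge> N" "E (G k) x \<noteq> 0"
    using infinite by blast
  then show False
    using N[of k] ge[of k] e(3)[of k x] by simp
qed

end

section \<open>The spectrum and the support of the spectral measure\<close>

locale spectral_operator = pvm E
  for E :: "real set \<Rightarrow> 'h \<Rightarrow> 'h::complex_hilbert" +
  fixes D :: "'h set" and A :: "'h \<Rightarrow> 'h"
  assumes is_spectral_measure: "is_spectral_measure E D A"
begin

abbreviation \<sigma> :: "real set"
  where "\<sigma> \<equiv> real_spectrum D A"

lemma dom_iff: "x \<in> D \<longleftrightarrow> sq_integrable (\<lambda>s. s) x"
proof -
  have "D = spectral_integral_dom E UNIV (\<lambda>s. s)"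
    using is_spectral_measure by (simp add: is_spectral_measure_def)
  then show ?thesis
    using spectral_integral_dom_iff[of UNIV "\<lambda>s. s" x] by simp
qed

lemma op_eq_calc:
  assumes "x \<in> D"
  shows "A x = calc (\<lambda>s. s) x"
proof -
  have "A x = spectral_integral E UNIV (\<lambda>s. s) x"
    using is_spectral_measure assms by (simp add: is_spectral_measure_def)
  then show ?thesis
    using spectral_integral_eq[of UNIV "\<lambda>s. s" x] assms by (simp add: dom_iff)
qed

lemma op_shift_eq_calc:
  assumes "x \<in> D"
  shows "A x - complex_of_real t *\<^sub>C x = calc (\<lambda>s. s - t) x"
  using assms by (simp add: op_eq_calc dom_iff calc_diff sq_integrable_const calc_const scaleR_scaleC)

text \<open>On vectors concentrated within \<open>e\<close> of \<open>t\<close>, the operator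
  \<open>A - t\<close> has norm at most \<open>e\<close>. A lower bound with constant
  \<open>C\<close> leaves only the zero vector there once
  \<open>\<bar>C\<bar> * e < 1\<close>.\<close>

lemma resolvent_set_imp_E_null:
  assumes "t \<notin> \<sigma>"
  shows "\<exists>e>0. \<forall>x. E {t - e<..<t + e} x = 0"
proof -
  obtain C where C: "\<And>x. x \<in> D \<Longrightarrow> norm x \<le> C * norm (A x - complex_of_real t *\<^sub>C x)"
    using assms by (auto simp: real_spectrum_def spectrum_def resolvent_set_def)
  \<comment> \<open>\<open>C\<close> may be zero or negative; the \<open>+ 1\<close> keeps the
    quotient positive and gives \<open>\<bar>C\<bar> * e < 1\<close>.\<close>
  define e where "e = 1 / (\<bar>C\<bar> + 1)"
  define I where "I = {t - e<..<t + e}"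
  have I [measurable]: "I \<in> sets borel"
    by (simp add: I_def)
  have "E I x = 0" for x
  proof -
    define y where "y = E I x"
    have y: "y \<in> D"
      unfolding y_def dom_iff
      by (rule sq_integrable_E[of _ _ "\<bar>t\<bar> + e"]) (auto simp: I_def)
    have "norm (calc (\<lambda>s. s - t) y) \<le> norm (calc (\<lambda>s. e * indicator I s) x)"
    proof -
      have le: "\<bar>(s - t) * indicator I s\<bar> \<le> \<bar>e * indicator I s\<bar>" for s
        by (auto simp: I_def indicator_def e_def abs_mult)
      have sq: "sq_integrable (\<lambda>s. e * indicator I s) x"
        by (intro sq_integrable_scale sq_integrable_simple simple_function_indicator) simp
      have "calc (\<lambda>s. s - t) y = calc (\<lambda>s. (s - t) * indicator I s) x"
        unfolding y_def calc_indicator[OF I, symmetric]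
        by (intro calc_calc sq_integrable_simple simple_function_indicator
            sq_integrable_mono[OF sq _ le]) simp_all
      then show ?thesis
        using norm_calc_mono[OF sq _ le] by simp
    qed
    also have "calc (\<lambda>s. e * indicator I s) x = e *\<^sub>R y"
      unfolding y_def calc_indicator[OF I, symmetric] by (intro calc_scaleR sq_integrable_simple) simp
    also have "norm (e *\<^sub>R y) = e * norm y"
      by (simp add: e_def)
    finally have *: "norm (A y - complex_of_real t *\<^sub>C y) \<le> e * norm y"
      by (simp add: op_shift_eq_calc y)
    have "norm y \<le> \<bar>C\<bar> * norm (A y - complex_of_real t *\<^sub>C y)"
      using C[OF y] by (rule order_trans) (simp add: mult_right_mono)
    also have "\<dots> \<le> \<bar>C\<bar> * (e * norm y)"
      by (rule mult_left_mono[OF *]) simp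
    finally have "norm y * (\<bar>C\<bar> + 1) \<le> \<bar>C\<bar> * norm y"
      by (simp add: e_def field_simps)
    then show "E I x = 0"
      by (simp add: y_def algebra_simps)
  qed
  then show ?thesis
    by (intro exI[of _ e]) (simp add: I_def e_def)
qed

text \<open>The resolvent is \<open>calc k\<close>, where \<open>k\<close> is
  \<open>1 / (s - t)\<close> set to \<open>0\<close> in the gap: there the quotient would be
  unbounded, but \<open>E\<close> does not see the change.\<close>

lemma E_null_imp_resolvent_set:
  assumes "e > 0" and null: "\<And>x. E {t - e<..<t + e} x = 0"
  shows "t \<notin> \<sigma>"
proof -
  define I where "I = {t - e<..<t + e}"
  have I [measurable]: "I \<in> sets borel"
    by (simp add: I_def)
  define k where "k s = (if s \<in> I then 0 else 1 / (s - t))" for s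
  have k [measurable]: "k \<in> borel_measurable borel"
    unfolding k_def by measurable
  have k_le: "\<bar>k s\<bar> \<le> 1 / e" for s
    using \<open>e > 0\<close> by (auto simp: k_def I_def field_simps abs_if)
  have k_shift: "(\<lambda>s. (s - t) * k s) = indicator (- I)"
    using \<open>e > 0\<close> by (auto simp: k_def I_def indicator_def)
  have E_compl: "E (- I) x = x" for x
    using E_Un[of I "- I" x] null[of x] by (simp add: E_UNIV I_def)
  have sq_k: "sq_integrable k x" for x
    using k_le by (intro sq_integrable_bounded) simp_all
  have calc_k_dom: "calc k x \<in> D" for x
  proof -
    have "\<bar>s * k s\<bar> \<le> 1 + \<bar>t\<bar> * (1 / e)" for s
    proof -
      have "s * k s = indicator (- I) s + t * k s"
        using fun_cong[OF k_shift, of s] by (simp add: algebra_simps)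
      moreover have "\<bar>t * k s\<bar> \<le> \<bar>t\<bar> * (1 / e)"
        unfolding abs_mult by (intro mult_left_mono k_le) simp
      moreover have "\<bar>indicator (- I) s :: real\<bar> \<le> 1"
        by (simp add: indicator_def)
      ultimately show ?thesis
        using abs_triangle_ineq[of "indicator (- I) s" "t * k s"] by linarith
    qed
    then show ?thesis
      unfolding dom_iff sq_integrable_calc_iff[OF sq_k measurable_ident_sets[OF refl]]
      by (intro sq_integrable_bounded) simp_all
  qed
  have sq_shift: "sq_integrable (\<lambda>s. s - t) x" if "x \<in> D" for x
    using that by (intro sq_integrable_diff sq_integrable_const) (simp add: dom_iff)
  have right: "A (calc k x) - complex_of_real t *\<^sub>C calc k x = x" for x
  proof -
    have "calc (\<lambda>s. s - t) (calc k x) = calc (indicator (- I)) x"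
      unfolding k_shift[symmetric]
      by (intro calc_calc sq_k) (simp_all add: k_shift sq_integrable_simple)
    then show ?thesis
      by (simp add: op_shift_eq_calc calc_k_dom calc_indicator E_compl)
  qed
  have left: "calc k (A x - complex_of_real t *\<^sub>C x) = x" if "x \<in> D" for x
  proof -
    have eq: "(\<lambda>s. k s * (s - t)) = indicator (- I)"
      unfolding k_shift[symmetric] by (simp add: mult.commute)
    have "calc k (calc (\<lambda>s. s - t) x) = calc (indicator (- I)) x"
      unfolding eq[symmetric]
      by (intro calc_calc sq_shift that) (simp_all add: eq sq_integrable_simple)
    then show ?thesis
      by (simp add: op_shift_eq_calc that calc_indicator E_compl)
  qed
  have "bij_betw (\<lambda>x. A x - complex_of_real t *\<^sub>C x) D UNIV"
    by (rule bij_betw_byWitness[where f' = "calc k"]) (auto simp: left right calc_k_dom)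
  moreover have "\<forall>x\<in>D. norm x \<le> 1 / e * norm (A x - complex_of_real t *\<^sub>C x)"
    using norm_calc_bounded_le[OF k k_le] left by metis
  ultimately show ?thesis
    unfolding real_spectrum_def spectrum_def resolvent_set_def by blast
qed

text \<open>Identifies the spectrum with the support of \<open>E\<close>. Closedness of the
  spectrum, its full measure and its lower bound all start from here.\<close>

lemma not_mem_spectrum_iff: "t \<notin> \<sigma> \<longleftrightarrow> (\<exists>e>0. \<forall>x. E {t - e<..<t + e} x = 0)"
  using resolvent_set_imp_E_null E_null_imp_resolvent_set by blast

lemma open_resolvent: "open (- \<sigma>)"
  unfolding open_dist
proof
  fix t
  assume "t \<in> - \<sigma>"
  then obtain e where e: "e > 0" "\<And>x. E {t - e<..<t + e} x = 0"
    using not_mem_spectrum_iff by auto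
  have "s \<in> - \<sigma>" if "dist s t < e / 2" for s
  proof -
    have "{s - e / 2<..<s + e / 2} \<subseteq> {t - e<..<t + e}"
      using that by (auto simp: dist_real_def abs_if split: if_splits)
    then have "E {s - e / 2<..<s + e / 2} x = 0" for x
      using E_null_subset[OF _ _ _ e(2)] by simp
    then show ?thesis
      using e(1) not_mem_spectrum_iff[of s] half_gt_zero by blast
  qed
  then show "\<exists>e>0. \<forall>s. dist s t < e \<longrightarrow> s \<in> - \<sigma>"
    using e(1) half_gt_zero by blast
qed

lemma sets_spectrum [measurable, simp]: "\<sigma> \<in> sets borel"
  using open_resolvent borel_closed[of \<sigma>] by (simp add: closed_def)

text \<open>Every point off the spectrum has a null neighbourhood; rational endpoints reduce these
  to countably many, and a countable union of null sets is null.\<close>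

lemma E_resolvent: "E (- \<sigma>) x = 0"
proof -
  define N where "N = {p \<in> \<rat> \<times> \<rat>. E {fst p<..<snd p} x = 0}"
  have "countable N"
    unfolding N_def by (rule countable_subset[of _ "\<rat> \<times> \<rat>"]) (auto intro: countable_rat)
  then have null: "(\<Union>p\<in>N. {fst p<..<snd p}) \<in> null_sets (\<mu> x)"
    by (rule null_sets_UN') (auto simp: N_def null_sets_def emeasure_scalar_measure)
  have "- \<sigma> \<subseteq> (\<Union>p\<in>N. {fst p<..<snd p})"
  proof
    fix t
    assume "t \<in> - \<sigma>"
    then obtain e where e: "e > 0" "\<And>x. E {t - e<..<t + e} x = 0"
      using not_mem_spectrum_iff by auto
    obtain p q where "p \<in> \<rat>" "t - e < p" "p < t" "q \<in> \<rat>" "t < q" "q < t + e"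
      using Rats_dense_in_real[of "t - e" t] Rats_dense_in_real[of t "t + e"] e(1) by auto
    moreover from this have "E {p<..<q} x = 0"
      by (intro E_null_subset[OF _ _ _ e(2)]) auto
    ultimately show "t \<in> (\<Union>p\<in>N. {fst p<..<snd p})"
      by (auto simp: N_def)
  qed
  then have "- \<sigma> \<in> null_sets (\<mu> x)"
    by (intro null_sets_subset[OF null]) simp_all
  then show ?thesis
    by (simp add: null_sets_def emeasure_scalar_measure)
qed

lemma E_spectrum: "E \<sigma> x = x"
  using E_Un[of \<sigma> "- \<sigma>" x] by (simp add: E_resolvent E_UNIV)

text \<open>A spectral point \<open>t\<close> below \<open>c\<close> would give a nonzero vector
  concentrated near \<open>t\<close>, with Rayleigh quotient below \<open>c\<close>.\<close>

lemma spectrum_ge: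
  assumes ge: "\<And>x. x \<in> D \<Longrightarrow> c * (norm x)\<^sup>2 \<le> Re (cinner (A x) x)" and "t \<in> \<sigma>"
  shows "c \<le> t"
proof (rule ccontr)
  assume "\<not> c \<le> t"
  \<comment> \<open>Half the distance to \<open>c\<close>: the window around \<open>t\<close> ends
    at the midpoint of \<open>t\<close> and \<open>c\<close>.\<close>
  define e where "e = (c - t) / 2"
  have "e > 0"
    using \<open>\<not> c \<le> t\<close> by (simp add: e_def)
  define I where "I = {t - e<..<t + e}"
  have I [measurable]: "I \<in> sets borel"
    by (simp add: I_def)
  obtain x where "E I x \<noteq> 0"
    using \<open>t \<in> \<sigma>\<close> \<open>e > 0\<close> not_mem_spectrum_iff unfolding I_def by blast
  define y where "y = E I x"
  have le: "\<bar>s * indicator I s\<bar> \<le> \<bar>t\<bar> + e" for s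
    using \<open>e > 0\<close> by (auto simp: I_def indicator_def)
  have sq: "sq_integrable (\<lambda>s. s * indicator I s) x"
    using le by (intro sq_integrable_bounded) simp_all
  have y: "y \<in> D"
    unfolding y_def dom_iff by (rule sq_integrable_E[of _ _ "\<bar>t\<bar> + e"]) (auto simp: I_def)
  have "A y = calc (\<lambda>s. s * indicator I s) x"
    unfolding op_eq_calc[OF y] unfolding y_def calc_indicator[OF I, symmetric]
    by (intro calc_calc sq sq_integrable_simple) simp_all
  then have "cinner (A y) y = cinner (E I (calc (\<lambda>s. s * indicator I s) x)) x"
    by (simp add: y_def E_commute)
  also have "E I (calc (\<lambda>s. s * indicator I s) x) = calc (\<lambda>s. s * indicator I s) x"
    unfolding E_calc[OF sq I] by (rule arg_cong[of _ _ "\<lambda>\<phi>. calc \<phi> x"]) (auto simp: indicator_def)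
  also have "cinner \<dots> x = complex_of_real (\<integral>s. s * indicator I s \<partial>\<mu> x)"
    by (rule cinner_calc_self[OF sq])
  finally have "Re (cinner (A y) y) = (\<integral>s. s * indicator I s \<partial>\<mu> x)"
    by simp
  also have "\<dots> \<le> (\<integral>s. (t + e) * indicator I s \<partial>\<mu> x)"
  proof (rule integral_mono)
    show "integrable (\<mu> x) (\<lambda>s. s * indicator I s)"
      using sq_integrable_mult[OF sq sq_integrable_const[of 1]] by simp
    show "integrable (\<mu> x) (\<lambda>s. (t + e) * indicator I s)"
      using finite_measure.emeasure_finite[OF finite_scalar_measure] by (simp add: less_top)
    show "s * indicator I s \<le> (t + e) * indicator I s" for s
      by (auto simp: I_def indicator_def)
  qed
  also have "\<dots> = (t + e) * (norm y)\<^sup>2"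
    by (simp add: measure_scalar_measure y_def)
  finally have "c * (norm y)\<^sup>2 \<le> (t + e) * (norm y)\<^sup>2"
    using ge[OF y] by linarith
  moreover have "0 < (norm y)\<^sup>2"
    using \<open>E I x \<noteq> 0\<close> by (simp add: y_def)
  ultimately have "c \<le> t + e"
    by simp
  then show False
    using \<open>e > 0\<close> by (simp add: e_def field_simps)
qed

end

section \<open>The damped wave operator\<close>

locale damped_wave = spectral_operator E D A
  for E :: "real set \<Rightarrow> 'h \<Rightarrow> 'h::complex_hilbert" and D :: "'h set" and A :: "'h \<Rightarrow> 'h" +
  fixes c :: real and f :: "real \<Rightarrow> real"
  assumes c_pos: "0 < c"
    and lower_bound: "\<And>x. x \<in> D \<Longrightarrow> c * (norm x)\<^sup>2 \<le> Re (cinner (A x) x)"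
    and f_cont: "continuous_on (real_spectrum D A) f"
    and f_nonneg: "\<And>s. s \<in> real_spectrum D A \<Longrightarrow> 0 \<le> f s"
begin

text \<open>\<open>f\<close> is constrained only on the spectrum; the cut-off makes it a Borel
  function on the line, as \<open>calc\<close> requires. The same device gives A^(1/2) and A^(-1) as
  \<open>sqrt_spec\<close> and \<open>recip\<close>.\<close>

definition damping :: "real \<Rightarrow> real"
  where "damping s = indicator \<sigma> s * f s"

definition sqrt_spec :: "real \<Rightarrow> real"
  where "sqrt_spec s = indicator \<sigma> s * sqrt s"

definition recip :: "real \<Rightarrow> real"
  where "recip s = indicator \<sigma> s / s"

lemma spectrum_pos: "s \<in> \<sigma> \<Longrightarrow> c \<le> s"
  by (rule spectrum_ge[OF lower_bound])

lemma measurable_damping [measurable]: "damping \<in> borel_measurable borel"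
  using borel_measurable_continuous_on_indicator[OF sets_spectrum f_cont]
  by (simp add: damping_def[abs_def])

lemma measurable_sqrt_spec [measurable]: "sqrt_spec \<in> borel_measurable borel"
  and measurable_recip [measurable]: "recip \<in> borel_measurable borel"
  unfolding sqrt_spec_def[abs_def] recip_def[abs_def] by measurable

lemma fcalc_dom_iff: "x \<in> fcalc_dom E D A f \<longleftrightarrow> sq_integrable damping x"
  using spectral_integral_dom_iff[of \<sigma> f x] measurable_damping
  by (simp add: fcalc_dom_def damping_def[abs_def])

lemma fcalc_eq: "sq_integrable damping x \<Longrightarrow> fcalc E D A f x = calc damping x"
  using spectral_integral_eq[of \<sigma> f x] by (simp add: fcalc_def damping_def[abs_def])

lemma sqrt_spec_eq: "(\<lambda>s. indicator \<sigma> s * s powr (1 / 2)) = sqrt_spec"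
proof
  show "indicator \<sigma> s * s powr (1 / 2) = sqrt_spec s" for s
    using spectrum_pos[of s] c_pos by (cases "s \<in> \<sigma>") (simp_all add: sqrt_spec_def powr_half_sqrt)
qed

lemma Hr_iff: "x \<in> Hr E D A 1 \<longleftrightarrow> sq_integrable sqrt_spec x"
  using spectral_integral_dom_iff[of \<sigma> "\<lambda>s. s powr (1 / 2)" x, unfolded sqrt_spec_eq]
  by (simp add: Hr_def fcalc_dom_def)

lemma Hr_norm_eq: "sq_integrable sqrt_spec x \<Longrightarrow> Hr_norm E D A 1 x = norm (calc sqrt_spec x)"
  using spectral_integral_eq[of \<sigma> "\<lambda>s. s powr (1 / 2)" x, unfolded sqrt_spec_eq]
  by (simp add: Hr_norm_def fcalc_def)

lemma recip_bounded: "\<bar>recip s\<bar> \<le> 1 / c"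
  using spectrum_pos[of s] c_pos by (cases "s \<in> \<sigma>") (simp_all add: recip_def frac_le)

lemma ident_mult_recip: "s * recip s = indicator \<sigma> s"
  using spectrum_pos[of s] c_pos by (cases "s \<in> \<sigma>") (simp_all add: recip_def)

lemma sqrt_spec_mult_recip_bounded: "\<bar>sqrt_spec s * recip s\<bar> \<le> 1 / sqrt c"
proof (cases "s \<in> \<sigma>")
  case True
  then have "sqrt_spec s * recip s = 1 / sqrt s"
    using spectrum_pos[of s] c_pos real_sqrt_mult_self[of s]
    by (simp add: sqrt_spec_def recip_def field_simps)
  then show ?thesis
    using spectrum_pos[OF True] c_pos by (simp add: frac_le)
qed (use c_pos in \<open>simp add: sqrt_spec_def\<close>)

section \<open>Truncated test vectors and uniqueness\<close>

definition core :: "nat \<Rightarrow> real set"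
  where "core n = {s. \<bar>s\<bar> \<le> real n \<and> \<bar>damping s\<bar> \<le> real n}"

lemma sets_core [measurable, simp]: "core n \<in> sets borel"
  unfolding core_def by measurable

lemma eventually_core: "\<forall>\<^sub>F n in sequentially. s \<in> core n"
  using eventually_ge_at_top[of "nat \<lceil>\<bar>s\<bar>\<rceil>"] eventually_ge_at_top[of "nat \<lceil>\<bar>damping s\<bar>\<rceil>"]
  unfolding core_def by eventually_elim (simp add: nat_ceiling_le_eq)

text \<open>Test vectors for \<open>represents\<close> must lie in two domains at once, and on
  \<open>core n\<close> both multipliers are bounded by \<open>n\<close>. The factor
  \<open>k\<close> is \<open>1\<close> for density, \<open>recip\<close> to reach a prescribed
  truncated vector as \<open>A w\<close>, and \<open>recip_root\<close> to make the
  \<open>H^1\<close> norm of \<open>u\<close> appear.\<close>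

lemma core_test_vector:
  fixes n z
  assumes [measurable]: "k \<in> borel_measurable borel" and le: "\<And>s. \<bar>k s\<bar> \<le> K"
  defines "w \<equiv> calc (\<lambda>s. indicator (core n) s * k s) z"
  shows "w \<in> D \<inter> fcalc_dom E D A f"
    and "A w = calc (\<lambda>s. s * (indicator (core n) s * k s)) z"
    and "fcalc E D A f w = calc (\<lambda>s. damping s * (indicator (core n) s * k s)) z"
    and "sq_integrable (\<lambda>s. indicator (core n) s * k s) x"
    and "sq_integrable (\<lambda>s. s * (indicator (core n) s * k s)) x"
    and "sq_integrable (\<lambda>s. damping s * (indicator (core n) s * k s)) x"
proof -
  have "0 \<le> K"
    using le[of 0] by simp
  have bound: "\<bar>\<phi> s * (indicator (core n) s * k s)\<bar> \<le> real n * K"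
    if "\<And>s. s \<in> core n \<Longrightarrow> \<bar>\<phi> s\<bar> \<le> real n" for \<phi> s
    using that[of s] le[of s] \<open>0 \<le> K\<close>
    by (cases "s \<in> core n") (auto simp: abs_mult intro: mult_mono)
  have "\<bar>indicator (core n) s * k s\<bar> \<le> K" for s
    using le[of s] \<open>0 \<le> K\<close> by (simp add: indicator_def)
  then show sq: "sq_integrable (\<lambda>s. indicator (core n) s * k s) x" for x
    by (intro sq_integrable_bounded) simp_all
  show sq_id: "sq_integrable (\<lambda>s. s * (indicator (core n) s * k s)) x" for x
    by (rule sq_integrable_bounded[OF _ bound]) (simp_all add: core_def)
  show sq_damping: "sq_integrable (\<lambda>s. damping s * (indicator (core n) s * k s)) x" for x
    by (rule sq_integrable_bounded[OF _ bound]) (simp_all add: core_def)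
  have "sq_integrable (\<lambda>s. s) w" "sq_integrable damping w"
    unfolding w_def by (simp_all add: sq_integrable_calc_iff sq sq_id sq_damping)
  then show "w \<in> D \<inter> fcalc_dom E D A f"
    by (simp add: dom_iff fcalc_dom_iff)
  then show "A w = calc (\<lambda>s. s * (indicator (core n) s * k s)) z"
    unfolding w_def by (simp add: op_eq_calc calc_calc sq sq_id)
  show "fcalc E D A f w = calc (\<lambda>s. damping s * (indicator (core n) s * k s)) z"
    using \<open>sq_integrable damping w\<close> unfolding w_def by (simp add: fcalc_eq calc_calc sq sq_damping)
qed

text \<open>The vectors \<open>E (core n) z\<close> make the common domain of \<open>A\<close> and
  \<open>f(A)\<close> dense, so the definite description in \<open>damped_op\<close> is
  determinate.\<close>

lemma represents_unique:
  assumes "represents E D A f u v h" "represents E D A f u v h'"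
  shows "h = h'"
proof -
  have "closure (D \<inter> fcalc_dom E D A f) = UNIV"
  proof -
    have "z \<in> closure (D \<inter> fcalc_dom E D A f)" for z
      unfolding closure_sequential
    proof (intro exI conjI allI)
      show "(\<lambda>n. E (core n) z) \<longlonglongrightarrow> z"
        by (rule E_tendsto[OF _ eventually_core]) simp
      show "E (core n) z \<in> D \<inter> fcalc_dom E D A f" for n
        using core_test_vector(1)[of "\<lambda>s. 1" 1 n z] by (simp add: calc_indicator)
    qed
    then show ?thesis
      by auto
  qed
  moreover have "cinner h w = cinner h' w" if "w \<in> D \<inter> fcalc_dom E D A f" for w
    using assms that unfolding represents_def by (metis cinner_commute)
  ultimately show ?thesis
    by (rule dense_cinner_eq_imp_eq)
qed

text \<open>A weak form of the injectivity of \<open>A\<close>: \<open>u\<close> and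
  \<open>u'\<close> agree on all \<open>A w\<close>. Taking for \<open>w\<close> the truncated
  inverse of \<open>A\<close> applied to \<open>z\<close> makes \<open>A w\<close> equal to
  \<open>E (core n) z\<close>, which tends to \<open>z\<close>.\<close>

lemma represents_inject:
  assumes "represents E D A f u v h" "represents E D A f u' v h"
  shows "u = u'"
proof (rule cinner_eq_imp_eq)
  fix z
  have eq: "cinner (E (core n) z) u = cinner (E (core n) z) u'" for n
  proof -
    note w = core_test_vector(1,2)[OF measurable_recip recip_bounded, where z = z and n = n]
    have "s * (indicator (core n) s * recip s) = indicator (core n \<inter> \<sigma>) s" for s
      unfolding mult.left_commute[of s] ident_mult_recip by (rule indicator_inter_arith[symmetric])
    then have "A (calc (\<lambda>s. indicator (core n) s * recip s) z) = E (core n \<inter> \<sigma>) z"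
      using w(2) by (simp add: calc_indicator)
    also have "\<dots> = E (core n) z"
      by (simp add: E_spectrum flip: E_E)
    finally show ?thesis
      using assms w(1) unfolding represents_def by (metis add_right_cancel)
  qed
  have "(\<lambda>n. E (core n) z) \<longlonglongrightarrow> z"
    by (rule E_tendsto[OF _ eventually_core]) simp
  then have "(\<lambda>n. cinner (E (core n) z) u) \<longlonglongrightarrow> cinner z u"
    "(\<lambda>n. cinner (E (core n) z) u') \<longlonglongrightarrow> cinner z u'"
    by (auto intro: cinner.tendsto)
  then have "cinner z u = cinner z u'"
    unfolding eq by (rule LIMSEQ_unique)
  then show "cinner u z = cinner u' z"
    by (metis cinner_commute)
qed

section \<open>Reduction of bijectivity to solvability\<close>

lemma damped_op_eq:
  assumes "represents E D A f u v h"
  shows "damped_op E D A f (u, v) = (v, - h)"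
proof -
  have "(THE h. represents E D A f u v h) = h"
    using assms represents_unique by blast
  then show ?thesis
    by (simp add: damped_op_def)
qed

lemma mem_damped_dom_iff:
  "(u, v) \<in> damped_dom E D A f \<longleftrightarrow>
    sq_integrable sqrt_spec u \<and> sq_integrable sqrt_spec v \<and> (\<exists>h. represents E D A f u v h)"
  by (auto simp: damped_dom_def phase_space_def Hr_iff)

lemma mem_phase_space_iff: "(u, v) \<in> phase_space E D A \<longleftrightarrow> sq_integrable sqrt_spec u"
  by (simp add: phase_space_def Hr_iff)

lemma inj_on_damped_op: "inj_on (damped_op E D A f) (damped_dom E D A f)"
proof (rule inj_onI, clarify)
  fix u v u' v'
  assume "(u, v) \<in> damped_dom E D A f" "(u', v') \<in> damped_dom E D A f"
    and eq: "damped_op E D A f (u, v) = damped_op E D A f (u', v')"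
  then obtain h h' where h: "represents E D A f u v h" "represents E D A f u' v' h'"
    by (auto simp: mem_damped_dom_iff)
  then have "v = v'" "h = h'"
    using eq by (simp_all add: damped_op_eq)
  with h show "u = u' \<and> v = v'"
    using represents_inject by blast
qed

text \<open>Injectivity is automatic, and the first component of the equation forces
  \<open>v = g\<close>; what remains is to find \<open>u\<close>. The sign of \<open>h\<close> is
  that of the second component of \<open>damped_op\<close>.\<close>

lemma bij_damped_op_iff:
  "bij_betw (damped_op E D A f) (damped_dom E D A f) (phase_space E D A) \<longleftrightarrow>
    (\<forall>g h. sq_integrable sqrt_spec g \<longrightarrow> (\<exists>u. sq_integrable sqrt_spec u \<and> represents E D A f u g (- h)))"
    (is "_ \<longleftrightarrow> ?surj")
proof
  assume bij: "bij_betw (damped_op E D A f) (damped_dom E D A f) (phase_space E D A)"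
  show ?surj
  proof (intro allI impI)
    fix g h
    assume "sq_integrable sqrt_spec g"
    then have "(g, h) \<in> damped_op E D A f ` damped_dom E D A f"
      using bij by (simp add: bij_betw_def mem_phase_space_iff)
    then obtain u v where uv: "(u, v) \<in> damped_dom E D A f" "damped_op E D A f (u, v) = (g, h)"
      by force
    then obtain h' where h': "represents E D A f u v h'"
      by (auto simp: mem_damped_dom_iff)
    then have "v = g" "h' = - h"
      using uv(2) by (auto simp: damped_op_eq)
    then show "\<exists>u. sq_integrable sqrt_spec u \<and> represents E D A f u g (- h)"
      using uv(1) h' by (auto simp: mem_damped_dom_iff)
  qed
next
  assume surj: ?surj
  have "damped_op E D A f p \<in> phase_space E D A" if "p \<in> damped_dom E D A f" for p
    using that by (cases p) (auto simp: mem_damped_dom_iff damped_op_eq mem_phase_space_iff)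
  moreover have "p \<in> damped_op E D A f ` damped_dom E D A f" if "p \<in> phase_space E D A" for p
  proof -
    obtain g h where p: "p = (g, h)"
      by fastforce
    with that have g: "sq_integrable sqrt_spec g"
      by (simp add: mem_phase_space_iff)
    with surj obtain u where u: "sq_integrable sqrt_spec u" "represents E D A f u g (- h)"
      by blast
    then have "damped_op E D A f (u, g) = p" "(u, g) \<in> damped_dom E D A f"
      using g p by (auto simp: mem_damped_dom_iff damped_op_eq)
    then show ?thesis
      by force
  qed
  ultimately show "bij_betw (damped_op E D A f) (damped_dom E D A f) (phase_space E D A)"
    using inj_on_damped_op by (auto simp: bij_betw_def)
qed

section \<open>Solving the equation when f/s is bounded\<close>

definition ratio :: "real \<Rightarrow> real"
  where "ratio s = damping s * recip s"

lemma measurable_ratio [measurable]: "ratio \<in> borel_measurable borel"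
  unfolding ratio_def[abs_def] by measurable

lemma ratio_eq: "s \<in> \<sigma> \<Longrightarrow> ratio s = f s / s"
  by (simp add: ratio_def damping_def recip_def)

lemma ratio_mult_ident: "ratio s * s = damping s"
proof -
  have "ratio s * s = damping s * (s * recip s)"
    by (simp add: ratio_def)
  then show ?thesis
    unfolding ident_mult_recip by (simp add: damping_def indicator_def)
qed

text \<open>\<open>calc recip\<close> and \<open>calc ratio\<close> are bounded and symmetric, so
  they move onto \<open>A w\<close>, where \<open>recip s * s\<close> is \<open>1\<close> on the
  spectrum and \<open>ratio s * s\<close> is \<open>damping s\<close>.\<close>

lemma represents_solution:
  assumes bounded: "\<And>s. \<bar>ratio s\<bar> \<le> C"
  shows "represents E D A f (- (calc recip h + calc ratio g)) g (- h)"
  unfolding represents_def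
proof
  fix w
  assume w: "w \<in> D \<inter> fcalc_dom E D A f"
  then have sq: "sq_integrable (\<lambda>s. s) w" "sq_integrable damping w"
    by (simp_all add: dom_iff fcalc_dom_iff)
  have sq_recip: "sq_integrable recip x" for x
    by (rule sq_integrable_bounded[OF measurable_recip recip_bounded])
  have sq_ratio: "sq_integrable ratio x" for x
    by (rule sq_integrable_bounded[OF measurable_ratio bounded])
  have recip: "(\<lambda>s. recip s * s) = indicator \<sigma>"
    unfolding ident_mult_recip[symmetric, abs_def] by (simp only: mult.commute)
  have "cinner (A w) (calc recip h) = cinner (calc recip (calc (\<lambda>s. s) w)) h"
    using w calc_commute[OF sq_recip sq_recip, of "calc (\<lambda>s. s) w" h] by (simp add: op_eq_calc)
  also have "calc recip (calc (\<lambda>s. s) w) = w"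
    using calc_calc[OF sq(1) measurable_recip] 
    by (simp add: recip sq_integrable_simple calc_indicator E_spectrum)
  finally have 1: "cinner (A w) (calc recip h) = cinner w h" .
  have "cinner (A w) (calc ratio g) = cinner (calc ratio (calc (\<lambda>s. s) w)) g"
    using w calc_commute[OF sq_ratio sq_ratio, of "calc (\<lambda>s. s) w" g] by (simp add: op_eq_calc)
  also have "calc ratio (calc (\<lambda>s. s) w) = fcalc E D A f w"
    using calc_calc[OF sq(1) measurable_ratio] sq(2) by (simp add: ratio_mult_ident fcalc_eq)
  finally show "cinner (A w) (- (calc recip h + calc ratio g)) + cinner (fcalc E D A f w) g =
      cinner w (- h)"
    using 1 by (simp add: cinner.minus_right cinner.diff_right)
qed

text \<open>Applying A^(1/2) to the solution leaves s^(-1/2), at most \<open>1 / sqrt c\<close>,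
  acting on \<open>h\<close>, and \<open>ratio\<close> acting on A^(1/2) g.\<close>

lemma solution_bound:
  fixes g h
  assumes bounded: "\<And>s. \<bar>ratio s\<bar> \<le> C" and g: "sq_integrable sqrt_spec g"
  defines "u \<equiv> - (calc recip h + calc ratio g)"
  shows "sq_integrable sqrt_spec u"
    and "norm (calc sqrt_spec u) \<le> 1 / sqrt c * norm h + C * norm (calc sqrt_spec g)"
proof -
  have "0 \<le> C"
    using bounded[of 0] by simp
  have sq_recip: "sq_integrable recip h"
    by (rule sq_integrable_bounded[OF measurable_recip recip_bounded])
  have sq_ratio: "sq_integrable ratio g"
    by (rule sq_integrable_bounded[OF measurable_ratio bounded])
  have sq1: "sq_integrable (\<lambda>s. sqrt_spec s * recip s) h"
    by (rule sq_integrable_bounded[OF _ sqrt_spec_mult_recip_bounded]) simp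
  have le: "\<bar>sqrt_spec s * ratio s\<bar> \<le> \<bar>C * sqrt_spec s\<bar>" for s
    unfolding abs_mult abs_of_nonneg[OF \<open>0 \<le> C\<close>] mult.commute[of "\<bar>sqrt_spec s\<bar>"]
    by (intro mult_right_mono bounded) simp
  have sq2: "sq_integrable (\<lambda>s. sqrt_spec s * ratio s) g"
    by (rule sq_integrable_mono[OF sq_integrable_scale[OF g] _ le]) simp
  have sq: "sq_integrable sqrt_spec (calc recip h)" "sq_integrable sqrt_spec (calc ratio g)"
    by (simp_all add: sq_integrable_calc_iff sq_recip sq_ratio sq1 sq2)
  show "sq_integrable sqrt_spec u"
    unfolding u_def by (intro sq_integrable_minus_right sq_integrable_add_right sq)
  have "calc sqrt_spec u = - (calc (\<lambda>s. sqrt_spec s * recip s) h + calc (\<lambda>s. sqrt_spec s * ratio s) g)"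
    unfolding u_def calc_minus_right[OF sq_integrable_add_right[OF sq]] calc_add_right[OF sq]
    by (simp add: calc_calc sq_recip sq_ratio sq1 sq2)
  then have "norm (calc sqrt_spec u) \<le>
      norm (calc (\<lambda>s. sqrt_spec s * recip s) h) + norm (calc (\<lambda>s. sqrt_spec s * ratio s) g)"
    by (simp only: norm_minus_cancel norm_triangle_ineq)
  moreover have "norm (calc (\<lambda>s. sqrt_spec s * recip s) h) \<le> 1 / sqrt c * norm h"
    by (rule norm_calc_bounded_le[OF _ sqrt_spec_mult_recip_bounded]) simp
  moreover have "norm (calc (\<lambda>s. sqrt_spec s * ratio s) g) \<le> C * norm (calc sqrt_spec g)"
    using norm_calc_mono[OF sq_integrable_scale[OF g] _ le] \<open>0 \<le> C\<close> by (simp add: calc_scaleR g)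
  ultimately show "norm (calc sqrt_spec u) \<le> 1 / sqrt c * norm h + C * norm (calc sqrt_spec g)"
    by linarith
qed

text \<open>\<open>1 \<le> sqrt s / sqrt c\<close> on the spectrum, where \<open>E\<close> is
  concentrated.\<close>

lemma norm_le_Hr_norm:
  assumes g: "sq_integrable sqrt_spec g"
  shows "norm g \<le> 1 / sqrt c * norm (calc sqrt_spec g)"
proof -
  have le: "\<bar>indicator \<sigma> s :: real\<bar> \<le> \<bar>1 / sqrt c * sqrt_spec s\<bar>" for s
    using spectrum_pos[of s] c_pos by (cases "s \<in> \<sigma>") (simp_all add: sqrt_spec_def)
  have "norm (calc (indicator \<sigma>) g) \<le> norm (calc (\<lambda>s. 1 / sqrt c * sqrt_spec s) g)"
    by (rule norm_calc_mono[OF sq_integrable_scale[OF g] _ le]) simp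
  then show ?thesis
    unfolding calc_scaleR[OF g] using c_pos by (simp add: calc_indicator E_spectrum)
qed

section \<open>Solvability forces f/s to be bounded\<close>

definition recip_root :: "real \<Rightarrow> real"
  where "recip_root s = indicator \<sigma> s / sqrt s"

lemma measurable_recip_root [measurable]: "recip_root \<in> borel_measurable borel"
  unfolding recip_root_def[abs_def] by measurable

lemma recip_root_bounded: "\<bar>recip_root s\<bar> \<le> 1 / sqrt c"
  using spectrum_pos[of s] c_pos by (cases "s \<in> \<sigma>") (simp_all add: recip_root_def frac_le)

lemma sqrt_spec_mult_recip_root: "sqrt_spec s * recip_root s = indicator \<sigma> s"
  using spectrum_pos[of s] c_pos by (cases "s \<in> \<sigma>") (simp_all add: sqrt_spec_def recip_root_def)

lemma ident_mult_recip_root: "s * recip_root s = sqrt_spec s"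
  using spectrum_pos[of s] c_pos
  by (cases "s \<in> \<sigma>") (simp_all add: sqrt_spec_def recip_root_def real_div_sqrt)

lemma recip_root_mult_recip_root: "recip_root s * recip_root s = recip s"
  using spectrum_pos[of s] c_pos by (cases "s \<in> \<sigma>") (simp_all add: recip_def recip_root_def)

text \<open>Restricted to \<open>core n\<close>, the formal identity A^(1/2) u = - (f/s)(A) y is
  legitimate. It bounds the truncated right side by the norm of A^(1/2) u uniformly in
  \<open>n\<close>, and \<open>sq_integrable_limit\<close> removes the truncation.\<close>

lemma solvable_imp_sq_integrable_ratio:
  assumes solvable: "\<And>g. sq_integrable sqrt_spec g \<Longrightarrow>
    \<exists>u. sq_integrable sqrt_spec u \<and> represents E D A f u g 0"
  shows "sq_integrable ratio y"
proof -
  have sq_rr: "sq_integrable recip_root x" for x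
    by (rule sq_integrable_bounded[OF measurable_recip_root recip_root_bounded])
  define g where "g = calc recip_root y"
  have "sq_integrable sqrt_spec g"
    unfolding g_def sq_integrable_calc_iff[OF sq_rr measurable_sqrt_spec] sqrt_spec_mult_recip_root
    by (intro sq_integrable_simple simple_function_indicator) simp
  then obtain u where u: "sq_integrable sqrt_spec u" "represents E D A f u g 0"
    using solvable by blast
  have trunc: "sq_integrable (\<lambda>s. indicator (core n) s * ratio s) y \<and>
      norm (calc (\<lambda>s. indicator (core n) s * ratio s) y) \<le> norm (calc sqrt_spec u)" for n
  proof -
    \<comment> \<open>The multipliers that produce \<open>A w\<close> and \<open>f(A) w\<close> from
      \<open>z\<close> when \<open>w\<close> is the test vector with \<open>k = recip_root\<close>.
      Thus \<open>\<alpha>\<close> is \<open>sqrt_spec\<close> cut off to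
      \<open>core n\<close>.\<close>
    define \<alpha> where "\<alpha> s = s * (indicator (core n) s * recip_root s)" for s
    define \<beta> where "\<beta> s = damping s * (indicator (core n) s * recip_root s)" for s
    note w = core_test_vector[OF measurable_recip_root recip_root_bounded, of n]
    have sq\<alpha>: "sq_integrable \<alpha> x" and sq\<beta>: "sq_integrable \<beta> x" for x
      using w(5,6) unfolding \<alpha>_def[abs_def] \<beta>_def[abs_def] by blast+
    note meas = sq_integrable_measurable[OF sq\<alpha>] sq_integrable_measurable[OF sq\<beta>]
    \<comment> \<open>Both multipliers are bounded, so they move from the arbitrary \<open>z\<close>
      onto \<open>u\<close> and \<open>g\<close>, and the weak equation becomes an identity of
      vectors.\<close>
    have "calc \<beta> g = - calc \<alpha> u"
    proof (rule cinner_eq_imp_eq)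
      fix z
      have "cinner (calc \<alpha> z) u + cinner (calc \<beta> z) g = 0"
        using bspec[OF u(2)[unfolded represents_def] w(1)[of z]]
        unfolding w(2,3) \<alpha>_def[abs_def] \<beta>_def[abs_def] by (simp only: cinner.zero_right)
      then have "cinner z (calc \<alpha> u + calc \<beta> g) = 0"
        by (simp only: calc_commute[OF sq\<alpha> sq\<alpha>] calc_commute[OF sq\<beta> sq\<beta>] cinner.add_right)
      then have "cinner (calc \<alpha> u + calc \<beta> g) z = 0"
        by (metis cinner_commute complex_cnj_zero)
      then show "cinner (calc \<beta> g) z = cinner (- calc \<alpha> u) z"
        by (simp add: cinner.add_left cinner.minus_left add_eq_0_iff)
    qed
    \<comment> \<open>The second factor \<open>recip_root\<close> comes from \<open>g\<close> and
      completes \<open>1 / s\<close>.\<close>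
    have \<beta>_rr: "(\<lambda>s. \<beta> s * recip_root s) = (\<lambda>s. indicator (core n) s * ratio s)"
    proof
      have "\<beta> s * recip_root s = indicator (core n) s * (damping s * (recip_root s * recip_root s))" for s
        by (simp add: \<beta>_def)
      then show "\<beta> s * recip_root s = indicator (core n) s * ratio s" for s
        by (simp only: recip_root_mult_recip_root ratio_def)
    qed
    have sq: "sq_integrable (\<lambda>s. indicator (core n) s * ratio s) y"
      using sq\<beta>[of g] unfolding g_def sq_integrable_calc_iff[OF sq_rr meas(2)] \<beta>_rr .
    have "calc (\<lambda>s. indicator (core n) s * ratio s) y = calc \<beta> g"
      using calc_calc[OF sq_rr meas(2), of y] sq unfolding g_def \<beta>_rr by simp
    moreover have "norm (calc \<alpha> u) \<le> norm (calc sqrt_spec u)"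
    proof (rule norm_calc_mono[OF u(1) meas(1)])
      have "\<alpha> s = indicator (core n) s * sqrt_spec s" for s
        by (simp add: \<alpha>_def ident_mult_recip_root[symmetric])
      then show "\<bar>\<alpha> s\<bar> \<le> \<bar>sqrt_spec s\<bar>" for s
        by (simp add: indicator_def)
    qed
    ultimately show ?thesis
      using sq \<open>calc \<beta> g = - calc \<alpha> u\<close> by simp
  qed
  have lim: "(\<lambda>n. indicator (core n) s * ratio s) \<longlonglongrightarrow> ratio s" for s
    by (intro tendsto_eventually eventually_mono[OF eventually_core[of s]]) simp
  show ?thesis
    by (rule sq_integrable_limit[OF conjunct1[OF trunc] measurable_ratio lim conjunct2[OF trunc]])
qed

lemma ratio_bounded:
  assumes sq: "\<And>y. sq_integrable ratio y"
  shows "\<exists>C. \<forall>s\<in>\<sigma>. f s / s \<le> C"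
proof -
  obtain C where C: "\<And>x. E {s. C < \<bar>ratio s\<bar>} x = 0"
    using sq_integrable_everywhere_imp_bounded[OF measurable_ratio sq] by blast
  have "f t / t \<le> C" if t: "t \<in> \<sigma>" for t
  proof (rule ccontr)
    assume "\<not> f t / t \<le> C"
    have "continuous_on \<sigma> (\<lambda>s. f s / s)"
      using spectrum_pos c_pos by (intro continuous_intros f_cont) force
    then have "((\<lambda>s. f s / s) \<longlongrightarrow> f t / t) (at t within \<sigma>)"
      using t by (simp add: continuous_on_def)
    then have "\<forall>\<^sub>F s in at t within \<sigma>. C < f s / s"
      by (rule order_tendstoD(1)) (use \<open>\<not> f t / t \<le> C\<close> in simp)
    then obtain d where d: "d > 0" "\<And>s. s \<in> \<sigma> \<Longrightarrow> s \<noteq> t \<Longrightarrow> dist s t < d \<Longrightarrow> C < f s / s"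
      unfolding eventually_at by auto
    \<comment> \<open>Only spectral points are compared: \<open>ratio\<close> vanishes off the
      spectrum, and \<open>E\<close> is concentrated on it.\<close>
    have sub: "{t - d<..<t + d} \<inter> \<sigma> \<subseteq> {s. C < \<bar>ratio s\<bar>}"
    proof
      fix s
      assume s: "s \<in> {t - d<..<t + d} \<inter> \<sigma>"
      \<comment> \<open>The limit says nothing at \<open>t\<close> itself, where the inequality is
        the assumption being refuted.\<close>
      then have "C < f s / s"
        using d(2)[of s] \<open>\<not> f t / t \<le> C\<close> by (cases "s = t") (auto simp: dist_real_def abs_if)
      then show "s \<in> {s. C < \<bar>ratio s\<bar>}"
        using s order_less_le_trans[OF _ abs_ge_self, of C "ratio s"] by (simp only: ratio_eq Int_iff mem_Collect_eq)
    qed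
    have "E {t - d<..<t + d} x = 0" for x
    proof -
      have "E {t - d<..<t + d} x = E ({t - d<..<t + d} \<inter> \<sigma>) x"
        by (simp add: E_spectrum flip: E_E)
      also have "\<dots> = 0"
        by (rule E_null_subset[OF _ _ sub C]) simp_all
      finally show ?thesis .
    qed
    then show False
      using t d(1) not_mem_spectrum_iff by blast
  qed
  then show ?thesis
    by blast
qed

text \<open>The one-sided bound becomes two-sided because \<open>f\<close> is nonnegative and the
  spectrum positive; \<open>\<bar>C\<bar>\<close> also covers the value \<open>0\<close> off the
  spectrum.\<close>

lemma abs_ratio_le:
  assumes "\<And>s. s \<in> \<sigma> \<Longrightarrow> f s / s \<le> C"
  shows "\<bar>ratio s\<bar> \<le> \<bar>C\<bar>"
proof (cases "s \<in> \<sigma>")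
  case True
  then have "0 \<le> f s / s"
    using spectrum_pos[OF True] c_pos f_nonneg[OF True] by simp
  then show ?thesis
    using assms[OF True] by (simp add: ratio_eq[OF True])
qed (simp add: ratio_def damping_def)

theorem bij_damped_op_iff_bounded:
  "bij_betw (damped_op E D A f) (damped_dom E D A f) (phase_space E D A) \<longleftrightarrow>
    (\<exists>C. \<forall>s\<in>\<sigma>. f s / s \<le> C)"
proof
  assume "bij_betw (damped_op E D A f) (damped_dom E D A f) (phase_space E D A)"
  then have "\<exists>u. sq_integrable sqrt_spec u \<and> represents E D A f u g 0" if "sq_integrable sqrt_spec g" for g
    using that unfolding bij_damped_op_iff by (metis minus_zero)
  then show "\<exists>C. \<forall>s\<in>\<sigma>. f s / s \<le> C"
    by (intro ratio_bounded solvable_imp_sq_integrable_ratio)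
next
  assume "\<exists>C. \<forall>s\<in>\<sigma>. f s / s \<le> C"
  then obtain C where "\<And>s. s \<in> \<sigma> \<Longrightarrow> f s / s \<le> C"
    by blast
  note bounded = abs_ratio_le[OF this]
  show "bij_betw (damped_op E D A f) (damped_dom E D A f) (phase_space E D A)"
    unfolding bij_damped_op_iff
    using represents_solution[OF bounded] solution_bound(1)[OF bounded] by blast
qed

section \<open>Boundedness of the inverse and the spectrum at zero\<close>

lemma phase_norm_eq:
  "sq_integrable sqrt_spec u \<Longrightarrow> phase_norm E D A (u, v) = sqrt ((norm (calc sqrt_spec u))\<^sup>2 + (norm v)\<^sup>2)"
  by (simp add: phase_norm_def Hr_norm_eq)

text \<open>By \<open>represents_inject\<close>, \<open>u\<close> is the explicit solution, and
  \<open>solution_bound\<close> contributes \<open>1 / sqrt c + \<bar>C\<bar>\<close>. The embedding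
  of \<open>H^1\<close> in H adds another \<open>1 / sqrt c\<close> for \<open>v\<close>.\<close>

lemma inverse_bounded:
  assumes "\<And>s. s \<in> \<sigma> \<Longrightarrow> f s / s \<le> C" and p: "p \<in> damped_dom E D A f"
  shows "phase_norm E D A p \<le> (2 / sqrt c + \<bar>C\<bar>) * phase_norm E D A (damped_op E D A f p)"
proof -
  note bounded = abs_ratio_le[OF assms(1)]
  obtain u v h where p_eq: "p = (u, v)" and sq: "sq_integrable sqrt_spec u" "sq_integrable sqrt_spec v"
    and h: "represents E D A f u v h"
    using p by (cases p) (auto simp: mem_damped_dom_iff)
  define N where "N = phase_norm E D A (damped_op E D A f p)"
  have N: "N = sqrt ((norm (calc sqrt_spec v))\<^sup>2 + (norm h)\<^sup>2)"
    by (simp add: N_def p_eq damped_op_eq[OF h] phase_norm_eq sq)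
  have "norm (calc sqrt_spec v) \<le> N" "norm h \<le> N"
    unfolding N by (rule real_sqrt_sum_squares_ge1, rule real_sqrt_sum_squares_ge2)
  have "represents E D A f (- (calc recip (- h) + calc ratio v)) v h"
    using represents_solution[OF bounded, of "- h" v] by simp
  then have "u = - (calc recip (- h) + calc ratio v)"
    by (rule represents_inject[OF h])
  then have "norm (calc sqrt_spec u) \<le> 1 / sqrt c * norm h + \<bar>C\<bar> * norm (calc sqrt_spec v)"
    using solution_bound(2)[OF bounded sq(2), of "- h"] by simp
  also have "\<dots> \<le> 1 / sqrt c * N + \<bar>C\<bar> * N"
    using \<open>norm (calc sqrt_spec v) \<le> N\<close> \<open>norm h \<le> N\<close> c_pos by (intro add_mono mult_left_mono) simp_all
  finally have u: "norm (calc sqrt_spec u) \<le> 1 / sqrt c * N + \<bar>C\<bar> * N" .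
  have "1 / sqrt c * norm (calc sqrt_spec v) \<le> 1 / sqrt c * N"
    using \<open>norm (calc sqrt_spec v) \<le> N\<close> c_pos by (intro mult_left_mono) simp_all
  then have v: "norm v \<le> 1 / sqrt c * N"
    using norm_le_Hr_norm[OF sq(2)] by linarith
  have "phase_norm E D A p \<le> norm (calc sqrt_spec u) + norm v"
    unfolding p_eq phase_norm_eq[OF sq(1)] by (rule sqrt_sum_squares_le_sum) simp_all
  also have "\<dots> \<le> (2 / sqrt c + \<bar>C\<bar>) * N"
    using add_mono[OF u v] by (simp add: algebra_simps)
  finally show ?thesis
    by (simp add: N_def)
qed

text \<open>\<open>resolvent_set\<close> also asks for a bounded inverse. Bijectivity already bounds
  \<open>f s / s\<close>, and that bound supplies it.\<close>

lemma bij_damped_op_iff_not_mem_spectrum: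
  "bij_betw (damped_op E D A f) (damped_dom E D A f) (phase_space E D A) \<longleftrightarrow>
    0 \<notin> spectrum (phase_space E D A) (phase_norm E D A) (damped_dom E D A f) (damped_op E D A f)"
proof -
  have "\<exists>K. \<forall>p\<in>damped_dom E D A f. phase_norm E D A p \<le> K * phase_norm E D A (damped_op E D A f p)"
    if "bij_betw (damped_op E D A f) (damped_dom E D A f) (phase_space E D A)"
    using that inverse_bounded unfolding bij_damped_op_iff_bounded by blast
  then show ?thesis
    by (auto simp: spectrum_def resolvent_set_def scaleC_zero_left)
qed

end

theorem theorem6p1:
  fixes D :: "'h::complex_hilbert set"
    and A :: "'h \<Rightarrow> 'h"
    and E :: "real set \<Rightarrow> 'h \<Rightarrow> 'h"
    and f :: "real \<Rightarrow> real"
  assumes separable: "\<exists>S::'h set. countable S \<and> closure S = UNIV"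
    and selfadj: "selfadjoint D A"
    and pos: "strictly_positive D A"
    and spectral: "is_spectral_measure E D A"
    and f_cont: "continuous_on (real_spectrum D A) f"
    and f_nonneg: "\<forall>s\<in>real_spectrum D A. 0 \<le> f s"
  shows "(bij_betw (damped_op E D A f) (damped_dom E D A f) (phase_space E D A) \<longleftrightarrow>
            (SUP s\<in>real_spectrum D A. ereal (f s / s)) < \<infinity>) \<and>
         (bij_betw (damped_op E D A f) (damped_dom E D A f) (phase_space E D A) \<longleftrightarrow>
            0 \<notin> spectrum (phase_space E D A) (phase_norm E D A)
                  (damped_dom E D A f) (damped_op E D A f))"
proof -
  obtain c where "0 < c" "\<And>x. x \<in> D \<Longrightarrow> c * (norm x)\<^sup>2 \<le> Re (cinner (A x) x)"
    using pos unfolding strictly_positive_def by blast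
  then interpret damped_wave E D A c f
    using spectral f_cont f_nonneg
    by unfold_locales (auto simp: is_spectral_measure_def)
  \<comment> \<open>In \<open>ereal\<close> the supremum always has a value; for an empty spectrum
    it is minus infinity, in accordance with every \<open>C\<close> being a bound.\<close>
  have "(SUP s\<in>\<sigma>. ereal (f s / s)) < \<infinity> \<longleftrightarrow> (\<exists>C. \<forall>s\<in>\<sigma>. f s / s \<le> C)"
  proof
    assume "(SUP s\<in>\<sigma>. ereal (f s / s)) < \<infinity>"
    then obtain n where "(SUP s\<in>\<sigma>. ereal (f s / s)) < ereal (real n)"
      using less_PInf_Ex_of_nat by auto
    then have "f s / s \<le> real n" if "s \<in> \<sigma>" for s
      using SUP_lessD[OF _ that] by fastforce
    then show "\<exists>C. \<forall>s\<in>\<sigma>. f s / s \<le> C"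
      by blast
  next
    assume "\<exists>C. \<forall>s\<in>\<sigma>. f s / s \<le> C"
    then obtain C where "\<And>s. s \<in> \<sigma> \<Longrightarrow> f s / s \<le> C"
      by blast
    then have "(SUP s\<in>\<sigma>. ereal (f s / s)) \<le> ereal C"
      by (intro SUP_least) simp
    then show "(SUP s\<in>\<sigma>. ereal (f s / s)) < \<infinity>"
      by (rule order_le_less_trans) simp
  qed
  then show ?thesis
    using bij_damped_op_iff_bounded bij_damped_op_iff_not_mem_spectrum by simp
qed

end
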